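(* Let $n,m\in\mathbb{N}$ be arbitrary with $0<m<n$, and let $\psi_{n,k}^m$, $k=1,\ldots,2n$, be the interpolating wavelets of order $n$ and parameter $m$. Then $$\int_{-1}^1x^s\,\psi_{n,k}^m(x)\,w(x)\,dx=0,\qquad s=0,1,\ldots,n-m,\quad k=1,\ldots,2n.$$ Moreover, the $\psi_{n,k}^m$ form a Riesz basis of $\mathcal{W}_n^m$ in the following sense: there exist absolute constants $C_1,C_2>0$, independent of $n$, $m$ and $\vec b_{2n}$, such that for every $\vec b_{2n}=(b_1,\ldots,b_{2n})\in\mathbb{R}^{2n}$ and every $1\le p\le\infty$, $$C_1\|\vec b_{2n}\|_{\ell^p}\le\Big\|\sum_{k=1}^{2n}b_k\psi_{n,k}^m\Big\|_p\le C(n,m)\,\|\vec b_{2n}\|_{\ell^p},\qquad C(n,m)=C_2\left(1+\log^2\frac nm\right).$$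
   Context: Let $w(x)=1/\sqrt{1-x^2}$ on $[-1,1]$ and $\langle f,g\rangle_{L^2_w}=\int_{-1}^1f(x)g(x)w(x)\,dx$; orthogonality is with respect to this scalar product. Norms: $\|f\|_\infty=\sup_{|x|\le1}|f(x)|$, $\|f\|_p=\left(\int_{-1}^1|f(x)|^pw(x)\,dx\right)^{1/p}$ for $1\le p<\infty$. For $\vec a_N\in\mathbb{R}^N$: $\|\vec a_N\|_{\ell^p}=\left(\frac{\pi}{N}\sum_{k=1}^N|a_k|^p\right)^{1/p}$ for $1\le p<\infty$ and $\|\vec a_N\|_{\ell^\infty}=\max_k|a_k|$ (used here with $N=2n$). Chebyshev nodes: $X_n=\{x_k^n=\cos\frac{(2k-1)\pi}{2n}:\ k=1,\ldots,n\}$. One has $X_n\subset X_{3n}$, and $Y_{2n}=X_{3n}\setminus X_n=\{y_k^n:\ k=1,\ldots,2n\}$. Orthonormal Chebyshev polynomials: $p_0=\sqrt{1/\pi}$, $p_r(x)=\sqrt{2/\pi}\cos(r\arccos x)$ for $r>0$. $K_r(x,y)=\sum_{s=0}^rp_s(x)p_s(y)$. For integers $0<m<N$: $v_N^m(x,y)=\frac1{2m}\sum_{r=N-m}^{N+m-1}K_r(x,y)$, $\Phi_N^m(x,y)=\frac{\pi}{N}v_N^m(x,y)$. Scaling functions: $\Phi_{N,k}^m(x)=\Phi_N^m(x_k^N,x)$, $k=1,\ldots,N$; they are linearly independent and $\mathcal{V}_N^m=\mathrm{span}\{\Phi_{N,k}^m:\ k=1,\ldots,N\}$. One has $\mathcal{V}_n^m\subset\mathcal{V}_{3n}^m$,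 and $\mathcal{W}_n^m$ is the orthogonal complement of $\mathcal{V}_n^m$ in $\mathcal{V}_{3n}^m$ (dimension $2n$). The interpolating wavelets $\psi_{n,k}^m$, $k=1,\ldots,2n$, are the unique basis of $\mathcal{W}_n^m$ with $\psi_{n,k}^m(y_h^n)=\delta_{h,k}$ for $h,k=1,\ldots,2n$; explicitly $\psi_{n,k}^m(x)=\Phi_{3n}^m(y_k^n,x)-\sum_{h=1}^n\Phi_{n,h}^m(y_k^n)\Phi_{3n}^m(x_h^n,x)$. *)

theory Defs
  imports "HOL-Analysis.Analysis" "HOL-Library.Function_Algebras"
begin

text \<open>
  Functions on \<open>[-1,1]\<close> are represented by functions \<open>real \<Rightarrow> real\<close>; the functions built from
  \<open>cheb_p\<close> below vanish outside \<open>[-1,1]\<close>, so that equality of such functions is equality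
  on \<open>[-1,1]\<close>.
\<close>

interpretation fun_space: vector_space "\<lambda>(c::real) (f::real \<Rightarrow> real) x. c * f x"
  by unfold_locales (auto simp: fun_eq_iff algebra_simps)

definition weight :: "real \<Rightarrow> real" where
  "weight x = 1 / sqrt (1 - x\<^sup>2)"

definition inner_w :: "(real \<Rightarrow> real) \<Rightarrow> (real \<Rightarrow> real) \<Rightarrow> real" where
  "inner_w f g = (LINT x:{-1..1}|lborel. f x * g x * weight x)"

definition norm_w :: "ereal \<Rightarrow> (real \<Rightarrow> real) \<Rightarrow> real" where
  "norm_w p f =
     (if p = \<infinity> then (SUP x\<in>{-1..1}. \<bar>f x\<bar>)
      else (LINT x:{-1..1}|lborel. \<bar>f x\<bar> powr real_of_ereal p * weight x)
             powr (1 / real_of_ereal p))"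

text \<open>A vector in \<open>\<real>\<^sup>N\<close> is given by the values of a function \<open>nat \<Rightarrow> real\<close> on \<open>{1..N}\<close>.\<close>

definition norm_l :: "ereal \<Rightarrow> nat \<Rightarrow> (nat \<Rightarrow> real) \<Rightarrow> real" where
  "norm_l p N a =
     (if p = \<infinity> then Max ((\<lambda>k. \<bar>a k\<bar>) ` {1..N})
      else (pi / real N * (\<Sum>k=1..N. \<bar>a k\<bar> powr real_of_ereal p))
             powr (1 / real_of_ereal p))"

definition cheb_node :: "nat \<Rightarrow> nat \<Rightarrow> real" where
  "cheb_node n k = cos ((2 * real k - 1) * pi / (2 * real n))"

definition X_nodes :: "nat \<Rightarrow> real set" where
  "X_nodes n = cheb_node n ` {1..n}"

definition Y_nodes :: "nat \<Rightarrow> real set" where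
  "Y_nodes n = X_nodes (3 * n) - X_nodes n"

definition cheb_p :: "nat \<Rightarrow> real \<Rightarrow> real" where
  "cheb_p r x =
     (if \<bar>x\<bar> \<le> 1
      then if r = 0 then sqrt (1 / pi) else sqrt (2 / pi) * cos (real r * arccos x)
      else 0)"

definition K_kernel :: "nat \<Rightarrow> real \<Rightarrow> real \<Rightarrow> real" where
  "K_kernel r x y = (\<Sum>s=0..r. cheb_p s x * cheb_p s y)"

definition v_kernel :: "nat \<Rightarrow> nat \<Rightarrow> real \<Rightarrow> real \<Rightarrow> real" where
  "v_kernel N m x y = 1 / (2 * real m) * (\<Sum>r=N-m..N+m-1. K_kernel r x y)"

definition Phi :: "nat \<Rightarrow> nat \<Rightarrow> real \<Rightarrow> real \<Rightarrow> real" where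
  "Phi N m x y = pi / real N * v_kernel N m x y"

definition scaling_fun :: "nat \<Rightarrow> nat \<Rightarrow> nat \<Rightarrow> real \<Rightarrow> real" where
  "scaling_fun N m k = Phi N m (cheb_node N k)"

definition V_space :: "nat \<Rightarrow> nat \<Rightarrow> (real \<Rightarrow> real) set" where
  "V_space N m = fun_space.span (scaling_fun N m ` {1..N})"

definition W_space :: "nat \<Rightarrow> nat \<Rightarrow> (real \<Rightarrow> real) set" where
  "W_space n m = {f \<in> V_space (3 * n) m. \<forall>g \<in> V_space n m. inner_w f g = 0}"

text \<open>For a node \<open>y = y_k\<close> of \<open>Y_nodes n\<close> this is the interpolating wavelet \<open>\<psi>_k\<close>.\<close>

definition wavelet :: "nat \<Rightarrow> nat \<Rightarrow> real \<Rightarrow> real \<Rightarrow> real" where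
  "wavelet n m y x =
     Phi (3 * n) m y x
       - (\<Sum>h=1..n. scaling_fun n m h y * Phi (3 * n) m (cheb_node n h) x)"

definition interpolating_basis ::
    "nat \<Rightarrow> nat \<Rightarrow> (nat \<Rightarrow> real) \<Rightarrow> (nat \<Rightarrow> real \<Rightarrow> real) \<Rightarrow> bool" where
  "interpolating_basis n m y \<psi> \<longleftrightarrow>
     inj_on \<psi> {1..2*n} \<and>
     fun_space.independent (\<psi> ` {1..2*n}) \<and>
     fun_space.span (\<psi> ` {1..2*n}) = W_space n m \<and>
     (\<forall>h\<in>{1..2*n}. \<forall>k\<in>{1..2*n}. \<psi> k (y h) = (if h = k then 1 else 0))"

end

(*
  Substituting x = cos t, the kernel v_N^m becomes (V(a - t) + V(a + t)) / (2 pi), where V is a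
  de la Vallee Poussin mean of Dirichlet kernels with the closed form
    (1 - cos u) m V(u) = sin(N u) sin(m u).
  It vanishes at the nonzero multiples of pi/N, which gives the interpolation property of the
  scaling functions, and it is at most a constant times N / ((1 + N u)(1 + m u)), whose integral is
  of order 1 + log(N/m).  Reproduction of low degrees in the integral inner product and in the
  discrete one (the nodes are Gauss nodes) makes the wavelets a basis of W_n^m, orthogonal to V_n^m
  and to low powers.

  For the norms, a kernel built from nonnegative Fejer sums gives a Marcinkiewicz inequality
  (pi/N) sum_k |f(x_k)|^p <= 9^p ||f||_p^p for all f of degree below 2N.  Applied to the function
  itself it is the lower bound; applied with p = 1 to v_N^m(x, .) it turns the integral bound for
  v_N^m into one for the node sums.  Both bounds for the matrix of wavelets are then of order
  (1 + log(n/m))^2, and a Schur test (Jensen) gives the upper bound for every p.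
*)
theory Submission
  imports Defs
begin

section \<open>Dirichlet kernels and their means\<close>

text \<open>The logarithm is squared because the correction term of \<open>wavelet\<close> chains
  two kernels, \<open>Phi n m\<close> and \<open>Phi (3 * n) m\<close>, and the absolute sums of
  each cost one factor of order \<open>1 + ln (n / m)\<close>. The lower bound carries no logarithm:
  the coefficients are values at nodes, and the kernel that controls node values has a mass
  independent of \<open>m\<close>. The obstacle there is that \<open>\<bar>f\<bar> powr p\<close> is
  in general not a polynomial, so exactness of quadrature says nothing about it. What is needed
  instead is a nonnegative kernel that dominates one reproducing \<open>f\<close> and has bounded
  integral and bounded node sums. Up to degree \<open>4 * N - 1\<close> the node sums of
  \<open>cheb_p s\<close> vanish except at \<open>s = 0\<close> and at the single aliased frequency
  \<open>s = 2 * N\<close>; this is why degrees below \<open>2 * N\<close> can be allowed.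
  Uniformity in \<open>p\<close> comes from constants that enter as p-th powers and survive the p-th
  root. That the wavelets span \<open>W_space n m\<close> is shown without a dimension count:
  orthogonality to the coarse scaling functions determines the values at \<open>X_nodes n\<close>
  from those at \<open>Y_nodes n\<close>.\<close>

lemma cos_of_nat_arccos_cos: "cos (real n * arccos (cos t)) = cos (real n * t)"
proof (induction n rule: less_induct)
  case (less n)
  have rec: "cos (real (Suc (Suc k)) * u) = 2 * cos u * cos (real (Suc k) * u) - cos (real k * u)" for k u
  proof -
    have "cos (real (Suc (Suc k)) * u) = cos (real (Suc k) * u + u)"
      by (simp add: algebra_simps)
    moreover have "cos (real k * u) = cos (real (Suc k) * u - u)"
      by (simp add: algebra_simps)
    ultimately show ?thesis
      by (simp add: cos_add cos_diff)
  qed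
  consider "n = 0" | "n = 1" | k where "n = Suc (Suc k)"
    by (metis One_nat_def not0_implies_Suc)
  then show ?case
  proof cases
    case 3
    then show ?thesis
      using less[of k] less[of "Suc k"] by (simp only: rec) (simp add: cos_arccos)
  qed (auto simp: cos_arccos)
qed

definition cheb_const :: "nat \<Rightarrow> real" where
  "cheb_const r = (if r = 0 then sqrt (1 / pi) else sqrt (2 / pi))"

text \<open>Valid for every real \<open>t\<close>, because \<open>cos (r * t)\<close> is a
  polynomial in \<open>cos t\<close>; no range condition on angles has to be carried along.\<close>

lemma cheb_p_cos: "cheb_p r (cos t) = cheb_const r * cos (real r * t)"
  by (auto simp: cheb_p_def cheb_const_def cos_of_nat_arccos_cos)

lemma cheb_const_sq: "cheb_const r * cheb_const r = (if r = 0 then 1 / pi else 2 / pi)"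
  by (auto simp: cheb_const_def real_sqrt_mult_self)

definition dirichlet :: "nat \<Rightarrow> real \<Rightarrow> real" where
  "dirichlet r u = 1 + 2 * (\<Sum>s=1..r. cos (real s * u))"

lemma dirichlet_0 [simp]: "dirichlet 0 u = 1"
  by (simp add: dirichlet_def)

lemma dirichlet_Suc: "dirichlet (Suc r) u = dirichlet r u + 2 * cos (real (Suc r) * u)"
  by (simp add: dirichlet_def algebra_simps)

lemma dirichlet_closed_form:
  "(1 - cos u) * dirichlet r u = cos (real r * u) - cos (real (Suc r) * u)"
proof (induction r)
  case (Suc r)
  have a: "cos (real r * u) = cos (real (Suc r) * u - u)"
    by (simp add: algebra_simps)
  have b: "cos (real (Suc (Suc r)) * u) = cos (real (Suc r) * u + u)"
    by (simp add: algebra_simps)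
  show ?case
    unfolding dirichlet_Suc distrib_left Suc.IH a b cos_add cos_diff by (simp add: algebra_simps)
qed simp

lemma dirichlet_minus [simp]: "dirichlet r (- u) = dirichlet r u"
  by (simp add: dirichlet_def)

lemma dirichlet_periodic: "dirichlet r (2 * pi - u) = dirichlet r u"
proof -
  \<comment> \<open>\<open>cos (s * v)\<close> depends only on \<open>cos v\<close>, and
    \<open>2 * pi - u\<close> has the same cosine as \<open>u\<close>.\<close>
  have "cos (real s * (2 * pi - u)) = cos (real s * u)" for s
    using cos_of_nat_arccos_cos[of s "2 * pi - u"] cos_of_nat_arccos_cos[of s u]
    by (simp add: cos_diff)
  then show ?thesis by (simp add: dirichlet_def)
qed

lemma dirichlet_at_period:
  assumes "cos u = 1" shows "dirichlet r u = 2 * real r + 1"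
proof -
  have "cos (real s * u) = 1" for s
    using cos_of_nat_arccos_cos[of s u] assms by simp
  then show ?thesis by (simp add: dirichlet_def)
qed

lemma abs_dirichlet_le: "\<bar>dirichlet r u\<bar> \<le> 2 * real r + 1"
proof -
  have "\<bar>\<Sum>s=1..r. cos (real s * u)\<bar> \<le> (\<Sum>s=1..r. 1)"
    by (rule order_trans[OF sum_abs sum_mono]) simp
  then show ?thesis by (simp add: dirichlet_def abs_le_iff)
qed

text \<open>The Fejer kernel up to normalization: telescoping the closed form gives
  \<open>1 - cos (L * u)\<close> after multiplication by \<open>1 - cos u\<close>. Points with
  \<open>cos u = 1\<close> are separate because that factor vanishes there.\<close>

lemma sum_dirichlet_nonneg: "0 \<le> (\<Sum>r<L. dirichlet r u)"
proof (cases "cos u = 1")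
  case True
  then show ?thesis by (auto intro!: sum_nonneg simp: dirichlet_at_period)
next
  case False
  have "(1 - cos u) * (\<Sum>r<L. dirichlet r u) = 1 - cos (real L * u)"
  proof (induction L)
    case (Suc L)
    then show ?case by (simp add: distrib_left dirichlet_closed_form)
  qed simp
  moreover have "0 < 1 - cos u"
    using False by (simp add: less_le)
  ultimately show ?thesis
    by (metis cos_le_one diff_ge_0_iff_ge zero_le_mult_iff not_le)
qed

lemma cheb_p_mult_cos:
  "cheb_p s (cos a) * cheb_p s (cos t) =
    (if s = 0 then 2 else 2 * (cos (real s * (a - t)) + cos (real s * (a + t)))) / (2 * pi)"
proof -
  have "cheb_p s (cos a) * cheb_p s (cos t) =
      (cheb_const s * cheb_const s) * (cos (real s * a) * cos (real s * t))"
    by (simp add: cheb_p_cos)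
  also have "\<dots> = (if s = 0 then 1 / pi else 2 / pi) *
      ((cos (real s * (a - t)) + cos (real s * (a + t))) / 2)"
    by (simp only: cheb_const_sq cos_times_cos right_diff_distrib distrib_left)
  finally show ?thesis by (auto simp: field_simps)
qed

lemma K_kernel_cos:
  "K_kernel r (cos a) (cos t) = (dirichlet r (a - t) + dirichlet r (a + t)) / (2 * pi)"
proof (induction r)
  case 0
  then show ?case by (simp add: K_kernel_def cheb_p_mult_cos)
next
  case (Suc r)
  have "K_kernel (Suc r) (cos a) (cos t) =
      K_kernel r (cos a) (cos t) + cheb_p (Suc r) (cos a) * cheb_p (Suc r) (cos t)"
    by (simp add: K_kernel_def)
  then show ?case
    unfolding Suc cheb_p_mult_cos dirichlet_Suc add_divide_distrib[symmetric]
    by (simp del: of_nat_Suc)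
qed

lemma obtain_angle:
  assumes "x \<in> {-1..1::real}"
  obtains a where "0 \<le> a" "a \<le> pi" "x = cos a"
  using assms arccos_bounded[of x] by (metis atLeastAtMost_iff cos_arccos)

lemma sum_K_kernel_nonneg:
  assumes "x \<in> {-1..1}" "y \<in> {-1..1}"
  shows "0 \<le> (\<Sum>r<L. K_kernel r x y)"
proof -
  obtain a t where "x = cos a" "y = cos t"
    using assms obtain_angle by metis
  then have "(\<Sum>r<L. K_kernel r x y) =
      ((\<Sum>r<L. dirichlet r (a - t)) + (\<Sum>r<L. dirichlet r (a + t))) / (2 * pi)"
    by (simp add: K_kernel_cos sum.distrib flip: sum_divide_distrib)
  then show ?thesis by (simp add: sum_dirichlet_nonneg)
qed

section \<open>The de la Vallee Poussin kernel: closed form and decay\<close>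

definition vp_kernel :: "nat \<Rightarrow> nat \<Rightarrow> real \<Rightarrow> real" where
  "vp_kernel N m u = (\<Sum>r=N-m..N+m-1. dirichlet r u) / (2 * real m)"

lemma v_kernel_cos:
  "v_kernel N m (cos a) (cos t) = (vp_kernel N m (a - t) + vp_kernel N m (a + t)) / (2 * pi)"
  unfolding v_kernel_def vp_kernel_def K_kernel_cos
  by (simp only: sum.distrib add_divide_distrib sum_divide_distrib[symmetric]) (simp add: add_divide_distrib mult_ac)

text \<open>Telescoping over the \<open>2 * m\<close> indices leaves
  \<open>cos ((N - m) * u) - cos ((N + m) * u)\<close>, which is twice the product of the
  sines.\<close>

lemma vp_kernel_closed_form:
  assumes "0 < m" "m < N"
  shows "(1 - cos u) * (real m * vp_kernel N m u) = sin (real N * u) * sin (real m * u)"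
proof -
  have tel: "(1 - cos u) * (\<Sum>r=j..<j+k. dirichlet r u) = cos (real j * u) - cos (real (j + k) * u)" for j k
  proof (induction k)
    case (Suc k)
    then show ?case by (simp add: distrib_left dirichlet_closed_form)
  qed simp
  have set: "{N-m..N+m-1} = {N-m..<(N-m)+2*m}"
    using assms by auto
  have "2 * ((1 - cos u) * (real m * vp_kernel N m u)) =
      (1 - cos u) * (\<Sum>r=N-m..<(N-m)+2*m. dirichlet r u)"
    unfolding vp_kernel_def set using assms(1) by simp
  also have "\<dots> = cos (real N * u - real m * u) - cos (real N * u + real m * u)"
    unfolding tel using assms by (simp add: of_nat_diff algebra_simps)
  also have "\<dots> = 2 * (sin (real N * u) * sin (real m * u))"
    by (simp add: cos_add cos_diff)
  finally show ?thesis by simp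
qed

lemma sum_vp_index:
  assumes "0 < m" "m < N"
  shows "(\<Sum>r=N-m..N+m-1. 2 * real r + 1) = 4 * real N * real m"
proof -
  have tel: "(\<Sum>r=j..<j+k. 2 * real r + 1) = (real (j + k))\<^sup>2 - (real j)\<^sup>2" for j k
    by (induction k) (auto simp: power2_eq_square algebra_simps)
  have set: "{N-m..N+m-1} = {N-m..<(N-m)+2*m}"
    using assms by auto
  show ?thesis
    unfolding set tel using assms by (simp add: of_nat_diff power2_eq_square algebra_simps)
qed

lemma vp_kernel_at_period:
  assumes "0 < m" "m < N" "cos u = 1"
  shows "vp_kernel N m u = 2 * real N"
  unfolding vp_kernel_def dirichlet_at_period[OF assms(3)] sum_vp_index[OF assms(1,2)]
  using assms by simp

lemma abs_vp_kernel_le: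
  assumes "0 < m" "m < N"
  shows "\<bar>vp_kernel N m u\<bar> \<le> 2 * real N"
proof -
  have "\<bar>\<Sum>r=N-m..N+m-1. dirichlet r u\<bar> \<le> (\<Sum>r=N-m..N+m-1. 2 * real r + 1)"
    by (rule order_trans[OF sum_abs sum_mono]) (rule abs_dirichlet_le)
  also note sum_vp_index[OF assms]
  finally show ?thesis
    using assms by (simp add: vp_kernel_def field_simps)
qed

lemma vp_kernel_minus [simp]: "vp_kernel N m (- u) = vp_kernel N m u"
  by (simp add: vp_kernel_def)

lemma vp_kernel_periodic: "vp_kernel N m (2 * pi - u) = vp_kernel N m u"
  by (simp add: vp_kernel_def dirichlet_periodic)

text \<open>With \<open>x = u / 2\<close> the right side is \<open>2 * (sin x)\<^sup>2\<close>. The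
  cubic Taylor bound gives \<open>x / 2 \<le> sin x\<close>, since \<open>x \<le> 8 / 5\<close>
  keeps \<open>x ^ 3 / 6\<close> below \<open>x / 2\<close>.\<close>

lemma one_minus_cos_ge:
  fixes u :: real
  assumes "0 \<le> u" "u \<le> pi"
  shows "u\<^sup>2 / 8 \<le> 1 - cos u"
proof -
  define x where "x = u / 2"
  have x: "0 \<le> x" "x \<le> 8 / 5"
    using assms pi_approx(2) by (simp_all add: x_def)
  have "\<bar>sin x - x\<bar> \<le> x ^ 3 / 6"
  proof -
    have "(\<Sum>i<3. sin_coeff i * x ^ i) = x"
      by (simp add: sin_coeff_def numeral_3_eq_3)
    moreover have "inverse (fact 3) * \<bar>x\<bar> ^ 3 = x ^ 3 / 6"
      using x by (simp add: fact_numeral)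
    ultimately show ?thesis
      using Maclaurin_sin_bound[of x 3] by (simp only:)
  qed
  moreover have "x ^ 3 / 6 \<le> x / 2"
  proof -
    have "x * x \<le> 8 / 5 * (8 / 5)"
      using x by (intro mult_mono) auto
    then have "x * (x * x) \<le> x * 3"
      using x by (intro mult_left_mono) auto
    then show ?thesis by (simp add: power3_eq_cube)
  qed
  ultimately have "x / 2 \<le> sin x" by linarith
  then have "(x / 2)\<^sup>2 \<le> (sin x)\<^sup>2"
    using x by (intro power_mono) auto
  moreover have "1 - cos u = 2 * (sin x)\<^sup>2"
    using cos_double_sin[of x] by (simp add: x_def)
  ultimately show ?thesis by (simp add: x_def power_divide)
qed

text \<open>Expanding \<open>(1 + N * u) * (1 + m * u)\<close> gives one term per regime: the
  trivial bound \<open>2 * N\<close>, then \<open>V * u \<le> 8\<close> from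
  \<open>\<bar>sin (m * u)\<bar> \<le> m * u\<close>, then \<open>m * V * u\<^sup>2 \<le> 8\<close>
  from boundedness of both sines. The constant is 2 + 16 + 8, with \<open>m < N\<close> absorbing
  \<open>m\<close>.\<close>

lemma vp_kernel_bound:
  assumes "0 < m" "m < N" "0 \<le> u" "u \<le> pi"
  shows "\<bar>vp_kernel N m u\<bar> \<le> 26 * real N / ((1 + real N * u) * (1 + real m * u))"
proof -
  define V where "V = \<bar>vp_kernel N m u\<bar>"
  have V0: "0 \<le> V" and V1: "V \<le> 2 * real N"
    using abs_vp_kernel_le[OF assms(1,2)] by (auto simp: V_def)
  have sn: "\<bar>sin x\<bar> \<le> \<bar>x\<bar>" "\<bar>sin x\<bar> \<le> 1" for x :: real
    by (auto simp: abs_sin_x_le_abs_x)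
  have "(u\<^sup>2 / 8) * (real m * V) \<le> (1 - cos u) * (real m * V)"
    using one_minus_cos_ge[OF assms(3,4)] V0 by (intro mult_right_mono) auto
  also have "\<dots> = \<bar>(1 - cos u) * (real m * vp_kernel N m u)\<bar>"
    by (simp add: V_def abs_mult)
  also have "\<dots> = \<bar>sin (real N * u)\<bar> * \<bar>sin (real m * u)\<bar>"
    by (simp only: vp_kernel_closed_form[OF assms(1,2)] abs_mult)
  finally have key: "real m * V * u\<^sup>2 \<le> 8 * (\<bar>sin (real N * u)\<bar> * \<bar>sin (real m * u)\<bar>)"
    by (simp add: mult_ac)
  have V2: "real m * V * u\<^sup>2 \<le> 8"
  proof -
    have "\<bar>sin (real N * u)\<bar> * \<bar>sin (real m * u)\<bar> \<le> 1 * 1"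
      by (intro mult_mono sn) auto
    with key show ?thesis by linarith
  qed
  have V3: "V * u \<le> 8"
  proof (cases "u = 0")
    case False
    have "\<bar>sin (real N * u)\<bar> * \<bar>sin (real m * u)\<bar> \<le> 1 * \<bar>real m * u\<bar>"
      by (intro mult_mono sn) auto
    with key have "(real m * u) * (V * u) \<le> (real m * u) * 8"
      using assms by (simp add: power2_eq_square algebra_simps)
    then show ?thesis
      using False assms by (simp add: mult_le_cancel_left)
  qed simp
  have "V * ((1 + real N * u) * (1 + real m * u)) =
      V + (real N + real m) * (V * u) + real N * (real m * V * u\<^sup>2)"
    by (simp add: algebra_simps power2_eq_square)
  also have "\<dots> \<le> 2 * real N + (real N + real m) * 8 + real N * 8"
    using V1 V2 V3 by (intro add_mono mult_left_mono) auto
  also have "\<dots> \<le> 26 * real N"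
    using assms by simp
  finally have "V * ((1 + real N * u) * (1 + real m * u)) \<le> 26 * real N" .
  moreover have "0 < (1 + real N * u) * (1 + real m * u)"
    using assms by (intro mult_pos_pos) (auto intro: add_pos_nonneg)
  ultimately show ?thesis
    by (simp add: V_def pos_le_divide_eq)
qed

lemma v_kernel_bound:
  assumes "0 < m" "m < N" "0 \<le> a" "a \<le> pi" "0 \<le> t" "t \<le> pi"
  shows "\<bar>v_kernel N m (cos a) (cos t)\<bar> \<le>
    9 * (real N / ((1 + real N * \<bar>a - t\<bar>) * (1 + real m * \<bar>a - t\<bar>)))"
proof -
  define B where "B u = real N / ((1 + real N * u) * (1 + real m * u))" for u
  have anti: "B v \<le> B u" if "0 \<le> u" "u \<le> v" for u v
    unfolding B_def using that
    by (intro divide_left_mono mult_mono mult_pos_pos add_mono mult_left_mono)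
       (auto intro: add_pos_nonneg)
  have vB: "\<bar>vp_kernel N m u\<bar> \<le> 26 * B u" if "0 \<le> u" "u \<le> pi" for u
    using vp_kernel_bound[OF assms(1,2) that] by (simp add: B_def)
  have 1: "\<bar>vp_kernel N m (a - t)\<bar> \<le> 26 * B \<bar>a - t\<bar>"
  proof -
    have "vp_kernel N m (a - t) = vp_kernel N m \<bar>a - t\<bar>"
      by (metis abs_if vp_kernel_minus)
    then show ?thesis using vB[of "\<bar>a - t\<bar>"] assms by simp
  qed
  \<comment> \<open>The bound for \<open>vp_kernel\<close> is available only on
    \<open>[0, pi]\<close>, so an angle \<open>a + t\<close> beyond \<open>pi\<close> is reflected
    to \<open>2 * pi - (a + t)\<close>. Either angle is at least \<open>\<bar>a - t\<bar>\<close>,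
    and \<open>B\<close> is decreasing.\<close>
  have 2: "\<bar>vp_kernel N m (a + t)\<bar> \<le> 26 * B \<bar>a - t\<bar>"
  proof (cases "a + t \<le> pi")
    case True
    then have "\<bar>vp_kernel N m (a + t)\<bar> \<le> 26 * B (a + t)"
      using assms by (intro vB) auto
    also have "\<dots> \<le> 26 * B \<bar>a - t\<bar>"
      using assms by (intro mult_left_mono anti) auto
    finally show ?thesis .
  next
    case False
    have "\<bar>vp_kernel N m (a + t)\<bar> = \<bar>vp_kernel N m (2 * pi - (a + t))\<bar>"
      by (simp only: vp_kernel_periodic)
    also have "\<dots> \<le> 26 * B (2 * pi - (a + t))"
      using False assms by (intro vB) auto
    also have "\<dots> \<le> 26 * B \<bar>a - t\<bar>"
      using assms by (intro mult_left_mono anti) auto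
    finally show ?thesis .
  qed
  have B0: "0 \<le> B \<bar>a - t\<bar>"
    by (simp add: B_def)
  have "\<bar>vp_kernel N m (a - t) + vp_kernel N m (a + t)\<bar> \<le> 52 * B \<bar>a - t\<bar>"
    using 1 2 by linarith
  \<comment> \<open>\<open>52 \<le> 54 < 18 * pi\<close>; the factor \<open>2 * pi\<close> is the
    denominator in \<open>v_kernel_cos\<close>.\<close>
  also have "\<dots> \<le> (9 * (2 * pi)) * B \<bar>a - t\<bar>"
    using B0 pi_gt3 by (intro mult_right_mono) auto
  finally have "\<bar>vp_kernel N m (a - t) + vp_kernel N m (a + t)\<bar> / (2 * pi) \<le> 9 * B \<bar>a - t\<bar>"
    by (simp add: field_simps)
  then show ?thesis
    by (simp add: v_kernel_cos B_def)
qed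

section \<open>Chebyshev nodes\<close>

definition node_angle :: "nat \<Rightarrow> nat \<Rightarrow> real" where
  "node_angle N k = (2 * real k - 1) * pi / (2 * real N)"

lemma cheb_node_angle: "cheb_node N k = cos (node_angle N k)"
  by (simp add: cheb_node_def node_angle_def)

lemma cheb_node_mem [simp]: "cheb_node N k \<in> {-1..1}"
  by (simp add: cheb_node_def)

lemma node_angle_bounds:
  assumes "k \<in> {1..N}"
  shows "0 < node_angle N k" "node_angle N k < pi"
proof -
  have "(2 * real k - 1) * pi < (2 * real N) * pi"
    using assms by (intro mult_strict_right_mono) auto
  then show "0 < node_angle N k" "node_angle N k < pi"
    using assms by (auto simp: node_angle_def field_simps)
qed

lemma inj_on_cheb_node: "inj_on (cheb_node N) {1..N}"
proof (rule inj_onI)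
  fix j k assume jk: "j \<in> {1..N}" "k \<in> {1..N}" and eq: "cheb_node N j = cheb_node N k"
  have "node_angle N j = node_angle N k"
    by (rule cos_inj_pi)
      (use node_angle_bounds[OF jk(1)] node_angle_bounds[OF jk(2)] eq in
        \<open>simp_all only: cheb_node_angle less_imp_le\<close>)
  then show "j = k"
    using jk by (simp add: node_angle_def)
qed

text \<open>Since \<open>2 * (3 * k - 1) - 1 = 3 * (2 * k - 1)\<close>, every third node of the fine
  grid is a coarse node.\<close>

lemma cheb_node_triple: "cheb_node n k = cheb_node (3 * n) (3 * k - 1)" if "1 \<le> k"
proof -
  have "real (3 * k - 1) = 3 * real k - 1"
    using that by (simp add: of_nat_diff)
  then have "(2 * real (3 * k - 1) - 1) * pi / (2 * real (3 * n)) =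
      (3 * ((2 * real k - 1) * pi)) / (3 * (2 * real n))"
    by (simp add: algebra_simps)
  also have "\<dots> = (2 * real k - 1) * pi / (2 * real n)"
    by (rule mult_divide_mult_cancel_left) simp
  finally show ?thesis
    by (simp only: cheb_node_def)
qed

lemma X_nodes_subset_triple: "X_nodes n \<subseteq> X_nodes (3 * n)"
proof
  fix z assume "z \<in> X_nodes n"
  then obtain k where k: "k \<in> {1..n}" "z = cheb_node n k"
    by (auto simp: X_nodes_def)
  then have "3 * k - 1 \<in> {1..3 * n}" "z = cheb_node (3 * n) (3 * k - 1)"
    using cheb_node_triple[of k n] by auto
  then show "z \<in> X_nodes (3 * n)"
    unfolding X_nodes_def by blast
qed

lemma Y_nodesD:
  assumes "z \<in> Y_nodes n"
  shows "z \<in> {-1..1}" "z \<in> X_nodes (3 * n)" "z \<notin> X_nodes n"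
  using assms unfolding Y_nodes_def X_nodes_def by (blast intro: cheb_node_mem)+

lemma sum_X_nodes: "(\<Sum>z\<in>X_nodes N. F z) = (\<Sum>k=1..N. F (cheb_node N k))"
  by (simp only: X_nodes_def sum.reindex[OF inj_on_cheb_node] comp_def)

lemma sum_nodes_split:
  fixes F :: "real \<Rightarrow> real"
  assumes "bij_betw y {1..2*n} (Y_nodes n)"
  shows "(\<Sum>k=1..3*n. F (cheb_node (3 * n) k)) =
    (\<Sum>k=1..2*n. F (y k)) + (\<Sum>h=1..n. F (cheb_node n h))"
proof -
  have "(\<Sum>z\<in>X_nodes (3 * n). F z) = (\<Sum>z\<in>Y_nodes n. F z) + (\<Sum>z\<in>X_nodes n. F z)"
    unfolding Y_nodes_def
    by (rule sum.subset_diff[OF X_nodes_subset_triple]) (simp add: X_nodes_def)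
  moreover have "(\<Sum>z\<in>Y_nodes n. F z) = (\<Sum>k=1..2*n. F (y k))"
    using sum.reindex_bij_betw[OF assms, of F] by (rule sym)
  ultimately show ?thesis
    by (simp add: sum_X_nodes)
qed

section \<open>Cosine sums over the nodes and discrete orthogonality\<close>

lemma sum_cos_odd: "2 * sin u * (\<Sum>k=1..N. cos ((2 * real k - 1) * u)) = sin (2 * real N * u)"
proof (induction N)
  case (Suc N)
  define w where "w = (2 * real (Suc N) - 1) * u"
  have "2 * real N * u = w - u" "2 * real (Suc N) * u = w + u"
    by (simp_all add: w_def algebra_simps)
  then have "sin (2 * real (Suc N) * u) = sin (2 * real N * u) + 2 * sin u * cos w"
    by (simp add: sin_add sin_diff)
  then show ?case
    using Suc by (simp add: distrib_left w_def del: of_nat_Suc)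
qed simp

text \<open>With \<open>u = s * pi / (2 * N)\<close> the right side of \<open>sum_cos_odd\<close> is
  \<open>sin (s * pi) = 0\<close>, while \<open>sin u\<close> vanishes only if \<open>2 * N\<close>
  divides \<open>s\<close>. In this range that is the frequency \<open>2 * N\<close>, where the
  cosine equals -1 at every node.\<close>

lemma sum_cos_node_angle:
  assumes "0 < s" "s < 4 * N" "s \<noteq> 2 * N"
  shows "(\<Sum>k=1..N. cos (real s * node_angle N k)) = 0"
proof -
  define u where "u = real s * pi / (2 * real N)"
  have N: "0 < N" using assms by auto
  have "real s * node_angle N k = (2 * real k - 1) * u" for k
    by (simp add: node_angle_def u_def)
  moreover have "sin u \<noteq> 0"
  proof
    assume "sin u = 0"
    then obtain i where i: "u = of_int i * pi"
      unfolding sin_zero_iff_int2 by auto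
    then have "real s = of_int i * (2 * real N)"
      using N by (simp add: u_def field_simps)
    then have "int s = i * (2 * int N)"
      by (metis (mono_tags) of_int_eq_iff of_int_mult of_int_numeral of_int_of_nat_eq)
    moreover from this have "0 < i"
      using assms(1) by (metis of_nat_0_less_iff zero_less_mult_pos2 N mult_2 add_pos_pos)
    moreover have "i < 2"
    proof (rule ccontr)
      assume "\<not> i < 2"
      then have "2 * (2 * int N) \<le> i * (2 * int N)"
        by (intro mult_right_mono) auto
      with \<open>int s = i * (2 * int N)\<close> assms(2) show False by linarith
    qed
    ultimately have "int s = 2 * int N" by auto
    then show False using assms(3) by linarith
  qed
  moreover have "sin (2 * real N * u) = 0"
    using N by (simp add: u_def sin_zero_iff_int2)
  ultimately show ?thesis
    using sum_cos_odd[of u N] by simp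
qed

lemma sum_cheb_p_nodes:
  assumes "0 < s" "s < 4 * N" "s \<noteq> 2 * N"
  shows "(\<Sum>k=1..N. cheb_p s (cheb_node N k)) = 0"
  by (simp only: cheb_node_angle cheb_p_cos sum_distrib_left[symmetric]
      sum_cos_node_angle[OF assms] mult_zero_right)

lemma cheb_p_double_node:
  assumes "0 < N" shows "cheb_p (2 * N) (cheb_node N k) = - sqrt (2 / pi)"
proof -
  have "real (2 * N) * node_angle N k = (2 * real k - 1) * pi"
    using assms by (simp add: node_angle_def)
  also have "\<dots> = 2 * pi * real k - pi"
    by (simp add: algebra_simps)
  finally have "real (2 * N) * node_angle N k = 2 * pi * real k - pi" .
  moreover have "cos (2 * pi * real k - pi) = -1"
    using cos_npi[of "2 * k"] by (simp add: cos_diff mult_ac)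
  ultimately show ?thesis
    using assms by (simp add: cheb_node_angle cheb_p_cos cheb_const_def)
qed

text \<open>Product-to-sum leads to node sums at the frequencies \<open>i - j\<close> and
  \<open>i + j\<close>; the hypothesis keeps both below the aliased frequency \<open>2 * N\<close>.
  This is exactness of Gauss quadrature for the product.\<close>

lemma discrete_orthogonality:
  assumes "i + j < 2 * N"
  shows "pi / real N * (\<Sum>k=1..N. cheb_p i (cheb_node N k) * cheb_p j (cheb_node N k)) =
    (if i = j then 1 else 0)"
proof -
  have N: "0 < N" using assms by auto
  have S: "(\<Sum>k=1..N. cos (real s * node_angle N k)) = (if s = 0 then real N else 0)"
    if "s < 2 * N" for s
    using sum_cos_node_angle[of s N] that by auto
  have wlog: "pi / real N * (\<Sum>k=1..N. cheb_p i (cheb_node N k) * cheb_p j (cheb_node N k)) =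
    (if i = j then 1 else 0)" if le: "j \<le> i" and lt: "i + j < 2 * N" for i j
  proof -
    have c: "cheb_p i (cheb_node N k) * cheb_p j (cheb_node N k) = cheb_const i * cheb_const j / 2 *
        (cos (real (i - j) * node_angle N k) + cos (real (i + j) * node_angle N k))" for k
    proof -
      have "cos (real i * node_angle N k) * cos (real j * node_angle N k) =
          (cos (real (i - j) * node_angle N k) + cos (real (i + j) * node_angle N k)) / 2"
        unfolding cos_times_cos using le by (simp add: of_nat_diff algebra_simps)
      then show ?thesis
        by (simp add: cheb_node_angle cheb_p_cos)
    qed
    have "pi / real N * (\<Sum>k=1..N. cheb_p i (cheb_node N k) * cheb_p j (cheb_node N k)) =
        pi / real N * (cheb_const i * cheb_const j / 2 *
        ((if i - j = 0 then real N else 0) + (if i + j = 0 then real N else 0)))"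
      using S[of "i - j"] S[of "i + j"] le lt
      by (simp only: c sum_distrib_left[symmetric] sum.distrib)
    also have "\<dots> = (if i = j then 1 else 0)"
      using le N cheb_const_sq[of i] by auto
    finally show ?thesis .
  qed
  show ?thesis
  proof (cases "j \<le> i")
    case True
    then show ?thesis using wlog assms by simp
  next
    case False
    then show ?thesis using wlog[of i j] assms by (simp add: mult.commute add.commute)
  qed
qed

lemma abs_cheb_p_le: "\<bar>cheb_p s x\<bar> \<le> sqrt (2 / pi)"
proof -
  have "sqrt (1 / pi) \<le> sqrt (2 / pi)"
    by (simp add: divide_right_mono)
  moreover have "sqrt (2 / pi) * \<bar>cos (real s * arccos x)\<bar> \<le> sqrt (2 / pi) * 1"
    by (intro mult_left_mono) auto
  ultimately show ?thesis
    by (auto simp: cheb_p_def abs_mult)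
qed

lemma K_kernel_commute: "K_kernel r x y = K_kernel r y x"
  by (simp add: K_kernel_def mult.commute)

lemma v_kernel_commute: "v_kernel N m x y = v_kernel N m y x"
  unfolding v_kernel_def by (simp add: K_kernel_commute[of _ x y])

text \<open>Below \<open>4 * N\<close> only the frequencies 0 and \<open>2 * N\<close> have a
  nonzero node sum. They contribute at most 1 and 2, whatever the degree \<open>r\<close>. The range
  extends to \<open>4 * N\<close> because \<open>marcinkiewicz_nodes\<close> uses kernels up to that
  degree.\<close>

lemma sum_nodes_K_kernel_le:
  assumes "r < 4 * N" "x \<in> {-1..1}"
  shows "pi / real N * (\<Sum>k=1..N. K_kernel r (cheb_node N k) x) \<le> 3"
proof -
  have N: "0 < N" using assms by auto
  define A where "A s = (\<Sum>k=1..N. cheb_p s (cheb_node N k)) * cheb_p s x" for s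
  have "(\<Sum>k=1..N. K_kernel r (cheb_node N k) x) = (\<Sum>s=0..r. A s)"
    unfolding K_kernel_def A_def sum_distrib_right by (rule sum.swap)
  also have "\<dots> = (\<Sum>s\<in>{0..r} \<inter> {0, 2 * N}. A s)"
  proof (rule sum.mono_neutral_right)
    show "\<forall>s\<in>{0..r} - {0..r} \<inter> {0, 2 * N}. A s = 0"
      using assms sum_cheb_p_nodes[of _ N] by (auto simp: A_def)
  qed auto
  also have "\<dots> \<le> (\<Sum>s\<in>{0..r} \<inter> {0, 2 * N}. \<bar>A s\<bar>)"
    by (rule sum_mono) simp
  also have "\<dots> \<le> (\<Sum>s\<in>{0, 2 * N}. \<bar>A s\<bar>)"
    by (rule sum_mono2) auto
  also have "\<dots> = \<bar>A 0\<bar> + \<bar>A (2 * N)\<bar>"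
    using N by simp
  also have "\<dots> \<le> real N / pi + real N * (2 / pi)"
  proof (rule add_mono)
    have "cheb_p 0 z = sqrt (1 / pi)" if "z \<in> {-1..1}" for z
      using that by (simp add: cheb_p_def abs_le_iff)
    then have "A 0 = real N * (sqrt (1 / pi) * sqrt (1 / pi))"
      using assms(2) cheb_node_mem by (simp only: A_def) (simp add: mult.assoc)
    then show "\<bar>A 0\<bar> \<le> real N / pi"
      by (simp only: real_sqrt_mult_self) simp
    have "\<bar>A (2 * N)\<bar> = real N * (sqrt (2 / pi) * \<bar>cheb_p (2 * N) x\<bar>)"
      using N by (simp add: A_def cheb_p_double_node abs_mult)
    also have "\<dots> \<le> real N * (sqrt (2 / pi) * sqrt (2 / pi))"
      by (intro mult_left_mono abs_cheb_p_le) auto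
    finally show "\<bar>A (2 * N)\<bar> \<le> real N * (2 / pi)"
      by (simp only: real_sqrt_mult_self) simp
  qed
  finally show ?thesis
    using N by (simp add: field_simps)
qed

lemma vp_kernel_lattice:
  assumes "0 < m" "m < N" "u = real_of_int l * pi / real N" "- 2 * pi < u" "u < 2 * pi"
  shows "vp_kernel N m u = (if u = 0 then 2 * real N else 0)"
proof (cases "u = 0")
  case True
  then show ?thesis using vp_kernel_at_period[of m N u] assms by simp
next
  case False
  have "cos u \<noteq> 1"
  proof
    assume "cos u = 1"
    then obtain i :: int where i: "u = of_int i * (2 * pi)"
      unfolding cos_one_2pi_int by (auto simp: mult_ac)
    have "of_int (- 1) * (2 * pi) < of_int i * (2 * pi)" "of_int i * (2 * pi) < of_int 1 * (2 * pi)"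
      using assms(4,5) unfolding i by simp_all
    moreover have pos: "0 < 2 * pi" by simp
    ultimately have "-1 < i" "i < 1"
      by (simp_all only: mult_less_cancel_right_pos[OF pos] of_int_less_iff)
    then show False using i False by simp
  qed
  moreover have "sin (real N * u) = 0"
    using assms by (simp add: sin_zero_iff_int2)
  ultimately show ?thesis
    using vp_kernel_closed_form[OF assms(1,2), of u] assms(1) False by simp
qed

text \<open>Differences and sums of two node angles are multiples of \<open>pi / N\<close> strictly
  between \<open>- 2 * pi\<close> and \<open>2 * pi\<close>, so only the zero angle contributes. The
  difference is zero just for \<open>j = k\<close>, the sum never.\<close>

lemma Phi_nodes:
  assumes "0 < m" "m < N" "j \<in> {1..N}" "k \<in> {1..N}"
  shows "Phi N m (cheb_node N j) (cheb_node N k) = (if j = k then 1 else 0)"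
proof -
  define d where "d = node_angle N j - node_angle N k"
  define e where "e = node_angle N j + node_angle N k"
  note bounds = node_angle_bounds[OF assms(3)] node_angle_bounds[OF assms(4)]
  have half: "2 * x / (2 * real N) = x / real N" for x
    by simp
  have "d = 2 * (real_of_int (int j - int k) * pi) / (2 * real N)"
    unfolding d_def node_angle_def diff_divide_distrib[symmetric]
    by (rule arg_cong[where f="\<lambda>z. z / (2 * real N)"]) (simp add: algebra_simps)
  moreover have "- 2 * pi < d" "d < 2 * pi"
    unfolding d_def using bounds pi_gt_zero by linarith+
  ultimately have d: "vp_kernel N m d = (if d = 0 then 2 * real N else 0)"
    unfolding half by (rule vp_kernel_lattice[OF assms(1,2)])
  have "e = 2 * (real_of_int (int j + int k - 1) * pi) / (2 * real N)"
    unfolding e_def node_angle_def add_divide_distrib[symmetric]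
    by (rule arg_cong[where f="\<lambda>z. z / (2 * real N)"]) (simp add: algebra_simps)
  moreover have "- 2 * pi < e" "e < 2 * pi"
    unfolding e_def using bounds pi_gt_zero by linarith+
  ultimately have e: "vp_kernel N m e = (if e = 0 then 2 * real N else 0)"
    unfolding half by (rule vp_kernel_lattice[OF assms(1,2)])
  have "d = 0 \<longleftrightarrow> j = k"
    using assms by (simp add: d_def node_angle_def)
  moreover have "e \<noteq> 0"
    using bounds by (simp add: e_def)
  moreover have "Phi N m (cheb_node N j) (cheb_node N k) =
      pi / real N * ((vp_kernel N m d + vp_kernel N m e) / (2 * pi))"
    by (simp add: Phi_def cheb_node_angle v_kernel_cos d_def e_def)
  ultimately show ?thesis
    using assms by (simp add: d e)
qed

text \<open>For \<open>r\<close> between \<open>N - m\<close> and \<open>N + m - 1\<close>, the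
  bound on \<open>i\<close> gives both \<open>i \<le> r\<close> and \<open>i + r < 2 * N\<close>, as
  discrete orthogonality requires. Every kernel in the mean then reproduces \<open>cheb_p i\<close>,
  hence so does the mean.\<close>

lemma cheb_p_Phi_expand:
  assumes "0 < m" "m < N" "i \<le> N - m"
  shows "cheb_p i x = (\<Sum>h=1..N. cheb_p i (cheb_node N h) * Phi N m (cheb_node N h) x)"
proof -
  have K: "pi / real N * (\<Sum>h=1..N. cheb_p i (cheb_node N h) * K_kernel r (cheb_node N h) x) = cheb_p i x"
    if "i \<le> r" "i + r < 2 * N" for r
  proof -
    have "pi / real N * (\<Sum>h=1..N. cheb_p i (cheb_node N h) * K_kernel r (cheb_node N h) x) =
        (\<Sum>s=0..r. (pi / real N * (\<Sum>h=1..N. cheb_p i (cheb_node N h) * cheb_p s (cheb_node N h))) * cheb_p s x)"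
      unfolding K_kernel_def sum_distrib_left sum_distrib_right
      by (subst sum.swap) (simp add: mult_ac)
    also have "\<dots> = (\<Sum>s=0..r. (if i = s then 1 else 0) * cheb_p s x)"
      using that by (intro sum.cong refl) (subst discrete_orthogonality, auto)
    also have "\<dots> = cheb_p i x"
      using that by (simp add: if_distrib[of "\<lambda>c. c * _"] cong: if_cong)
    finally show ?thesis .
  qed
  have "(\<Sum>h=1..N. cheb_p i (cheb_node N h) * Phi N m (cheb_node N h) x) =
      1 / (2 * real m) * (\<Sum>r=N-m..N+m-1.
        pi / real N * (\<Sum>h=1..N. cheb_p i (cheb_node N h) * K_kernel r (cheb_node N h) x))"
    unfolding Phi_def v_kernel_def sum_distrib_left
    by (subst sum.swap) (simp add: mult_ac)
  also have "\<dots> = 1 / (2 * real m) * (\<Sum>r=N-m..N+m-1. cheb_p i x)"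
    using assms by (intro arg_cong2[where f="(*)"] refl sum.cong K) auto
  also have "\<dots> = cheb_p i x"
    using assms by simp
  finally show ?thesis ..
qed

section \<open>Integrals with the Chebyshev weight and reproducing kernels\<close>

text \<open>The weighted integral after substituting \<open>x = cos t\<close>: the weight cancels
  the Jacobian, so a continuous \<open>f\<close> gives a continuous integrand.\<close>

definition cheb_integral :: "(real \<Rightarrow> real) \<Rightarrow> real" where
  "cheb_integral f = integral {0..pi} (\<lambda>t. f (cos t))"

abbreviation cont :: "(real \<Rightarrow> real) \<Rightarrow> bool" where
  "cont f \<equiv> continuous_on {-1..1} f"

lemma continuous_on_comp_cos:
  assumes "cont f" shows "continuous_on S (\<lambda>t. f (cos t))"
  by (rule continuous_on_compose2[OF assms]) (auto intro: continuous_intros)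

lemma integrable_comp_cos:
  assumes "cont f" shows "(\<lambda>t. f (cos t)) integrable_on {0..pi}"
  by (intro integrable_continuous_interval continuous_on_comp_cos assms)

lemma cos_image_Icc: "cos ` {0..pi} = {-1..1::real}"
proof
  show "{-1..1::real} \<subseteq> cos ` {0..pi}"
  proof
    fix x :: real assume "x \<in> {-1..1}"
    then obtain a where "0 \<le> a" "a \<le> pi" "x = cos a"
      by (rule obtain_angle)
    then show "x \<in> cos ` {0..pi}" by auto
  qed
qed auto

text \<open>Change of variables by \<open>cos\<close>. At the end points \<open>weight\<close> has
  the value \<open>1 / 0 = 0\<close> and the integrands may disagree, so the null set
  \<open>{0, pi}\<close> is removed.\<close>

lemma lborel_integral_weight:
  assumes "cont f"
  shows "(LINT x:{-1..1}|lborel. f x * weight x) = cheb_integral f"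
proof -
  define h where "h x = f x * weight x" for x
  have eq: "\<bar>- sin t\<bar> * h (cos t) = f (cos t)" if "t \<in> {0..pi} - {0, pi}" for t
  proof -
    have "0 < sin t" using that by (intro sin_gt_zero) auto
    moreover have "sqrt (1 - (cos t)\<^sup>2) = \<bar>sin t\<bar>"
      by (simp flip: sin_squared_eq)
    ultimately show ?thesis by (simp add: h_def weight_def)
  qed
  have int: "(\<lambda>t. f (cos t)) absolutely_integrable_on {0..pi}"
    by (intro absolutely_integrable_continuous_real continuous_on_comp_cos assms)
  have "(\<lambda>t. \<bar>- sin t\<bar> * h (cos t)) absolutely_integrable_on {0..pi}"
    by (rule absolutely_integrable_spike[OF int, of "{0, pi}"]) (simp, erule eq)
  moreover have "integral {0..pi} (\<lambda>t. \<bar>- sin t\<bar> * h (cos t)) = cheb_integral f"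
    unfolding cheb_integral_def
    by (rule integral_spike[of "{0, pi}"]) (simp, erule eq[symmetric])
  moreover have "(cos has_field_derivative - sin t) (at t within {0..pi})" for t :: real
    by (rule DERIV_subset[OF DERIV_cos]) simp
  moreover have "inj_on cos {0..pi}"
    by (rule inj_onI) (auto intro: cos_inj_pi)
  ultimately have lebesgue: "h absolutely_integrable_on {-1..1}" "integral {-1..1} h = cheb_integral f"
    using has_absolute_integral_change_of_variables_1'[of "{0..pi}" cos "\<lambda>t. - sin t" h "cheb_integral f"]
    unfolding cos_image_Icc by auto
  \<comment> \<open>The substitution rule yields Lebesgue integrability; Borel measurability is
    added to pass to \<open>lborel\<close>.\<close>
  have "(\<lambda>x. (indicator {-1..1} x *\<^sub>R f x) * weight x) \<in> borel_measurable lborel"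
  proof (rule borel_measurable_times)
    show "(\<lambda>x. indicator {-1..1} x *\<^sub>R f x) \<in> borel_measurable lborel"
      using borel_measurable_continuous_on_indicator[OF _ assms] by simp
    show "weight \<in> borel_measurable lborel"
      unfolding weight_def by measurable
  qed
  then have "(\<lambda>x. indicator {-1..1} x *\<^sub>R h x) \<in> borel_measurable lborel"
    by (simp add: h_def mult.assoc)
  then have "set_integrable lborel {-1..1} h"
    using lebesgue(1) unfolding set_integrable_def by (simp add: integrable_completion)
  from set_borel_integral_eq_integral(2)[OF this] show ?thesis
    by (simp add: lebesgue(2)) (simp add: h_def)
qed

lemma cheb_integral_cong:
  assumes "\<And>x. x \<in> {-1..1} \<Longrightarrow> f x = g x"
  shows "cheb_integral f = cheb_integral g"
  unfolding cheb_integral_def by (rule integral_cong) (use assms in auto)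

lemma cheb_integral_add:
  assumes "cont f" "cont g"
  shows "cheb_integral (\<lambda>x. f x + g x) = cheb_integral f + cheb_integral g"
  unfolding cheb_integral_def by (intro integral_add integrable_comp_cos assms)

lemma cheb_integral_cmult: "cheb_integral (\<lambda>x. c * f x) = c * cheb_integral f"
  unfolding cheb_integral_def by simp

lemma cheb_integral_sum:
  assumes "finite I" "\<And>i. i \<in> I \<Longrightarrow> cont (f i)"
  shows "cheb_integral (\<lambda>x. \<Sum>i\<in>I. f i x) = (\<Sum>i\<in>I. cheb_integral (f i))"
  unfolding cheb_integral_def by (intro integral_sum integrable_comp_cos assms)

lemma cheb_integral_mono:
  assumes "cont f" "cont g" "\<And>x. x \<in> {-1..1} \<Longrightarrow> f x \<le> g x"
  shows "cheb_integral f \<le> cheb_integral g"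
  unfolding cheb_integral_def
  by (intro integral_le integrable_comp_cos assms) (use assms in auto)

lemma abs_cheb_integral_le:
  assumes "cont f" "cont g" "\<And>x. x \<in> {-1..1} \<Longrightarrow> \<bar>f x\<bar> \<le> g x"
  shows "\<bar>cheb_integral f\<bar> \<le> cheb_integral g"
proof -
  have "cheb_integral f \<le> cheb_integral g"
    using assms by (intro cheb_integral_mono) (auto simp: abs_le_iff)
  moreover have "cheb_integral (\<lambda>x. - 1 * f x) \<le> cheb_integral g"
    using assms by (intro cheb_integral_mono continuous_on_mult_left) (auto simp: abs_le_iff)
  ultimately show ?thesis
    unfolding cheb_integral_cmult by linarith
qed

lemma cheb_integral_nonneg:
  assumes "cont f" "\<And>x. x \<in> {-1..1} \<Longrightarrow> 0 \<le> f x"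
  shows "0 \<le> cheb_integral f"
  using cheb_integral_mono[OF continuous_on_const[of _ 0] assms(1)] assms(2)
  by (simp add: cheb_integral_def)

lemma continuous_on_cheb_p [continuous_intros]: "cont (cheb_p r)"
proof -
  have "cont (\<lambda>x. if r = 0 then sqrt (1 / pi) else sqrt (2 / pi) * cos (real r * arccos x))"
    by (cases "r = 0") (auto intro!: continuous_intros)
  then show ?thesis
    by (rule continuous_on_cong[THEN iffD1, rotated 2]) (auto simp: cheb_p_def)
qed

lemma continuous_on_K_kernel [continuous_intros]: "cont (K_kernel r x)"
  unfolding K_kernel_def by (intro continuous_intros)

lemma continuous_on_v_kernel [continuous_intros]: "cont (v_kernel N m x)"
  unfolding v_kernel_def by (intro continuous_intros)

lemma continuous_on_Phi [continuous_intros]: "cont (Phi N m x)"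
  unfolding Phi_def by (intro continuous_intros)

lemma continuous_on_wavelet [continuous_intros]: "cont (wavelet n m z)"
  unfolding wavelet_def by (intro continuous_intros)

lemma inner_w_eq:
  assumes "cont f" "cont g"
  shows "inner_w f g = cheb_integral (\<lambda>x. f x * g x)"
  unfolding inner_w_def by (rule lborel_integral_weight) (intro continuous_intros assms)

lemma integral_cos_of_nat:
  "integral {0..pi} (\<lambda>t. cos (real s * t)) = (if s = 0 then pi else 0)"
proof (cases "s = 0")
  case False
  have "((\<lambda>t. cos (real s * t)) has_integral
      (sin (real s * pi) / real s - sin (real s * 0) / real s)) {0..pi}"
    by (rule fundamental_theorem_of_calculus)
      (use False in \<open>auto intro!: derivative_eq_intros
        simp flip: has_real_derivative_iff_has_vector_derivative\<close>)
  then show ?thesis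
    using False by (simp add: integral_unique)
qed simp

lemma cheb_p_orthonormal:
  "cheb_integral (\<lambda>x. cheb_p i x * cheb_p j x) = (if i = j then 1 else 0)"
proof (induction i j rule: linorder_wlog)
  case (le j i)
  have c: "cheb_p j (cos t) * cheb_p i (cos t) = cheb_const j * cheb_const i / 2 *
      (cos (real (i - j) * t) + cos (real (i + j) * t))" for t
  proof -
    have E: "cos (real i * t) * cos (real j * t) = (cos (real (i - j) * t) + cos (real (i + j) * t)) / 2"
      unfolding cos_times_cos using le by (simp add: of_nat_diff algebra_simps)
    have "cheb_p j (cos t) * cheb_p i (cos t) =
        cheb_const j * cheb_const i * (cos (real i * t) * cos (real j * t))"
      by (simp add: cheb_p_cos mult_ac)
    then show ?thesis
      unfolding E by simp
  qed
  have ii: "(\<lambda>t. cos (real s * t)) integrable_on {0..pi}" for s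
    by (intro integrable_continuous_interval continuous_intros)
  have "cheb_integral (\<lambda>x. cheb_p j x * cheb_p i x) =
      cheb_const j * cheb_const i / 2 *
      ((if i - j = 0 then pi else 0) + (if i + j = 0 then pi else 0))"
    unfolding cheb_integral_def c
    by (simp only: integral_mult_right integral_add[OF ii ii] integral_cos_of_nat)
  also have "\<dots> = (if j = i then 1 else 0)"
    using le cheb_const_sq[of i] by auto
  finally show ?case .
next
  case (sym i j)
  then show ?case by (simp add: mult.commute eq_commute)
qed

section \<open>Reproducing kernels on spaces of bounded degree\<close>

lemma K_kernel_reproduces_cheb_p:
  assumes "i \<le> r"
  shows "cheb_integral (\<lambda>y. cheb_p i y * K_kernel r x y) = cheb_p i x"
proof -
  have "cheb_integral (\<lambda>y. cheb_p i y * K_kernel r x y) =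
      cheb_integral (\<lambda>y. \<Sum>s=0..r. cheb_p s x * (cheb_p i y * cheb_p s y))"
    by (rule cheb_integral_cong) (simp add: K_kernel_def sum_distrib_left mult_ac)
  also have "\<dots> = (\<Sum>s=0..r. cheb_p s x * (if i = s then 1 else 0))"
    by (subst cheb_integral_sum)
      (auto intro!: continuous_intros simp only: cheb_integral_cmult cheb_p_orthonormal)
  also have "\<dots> = cheb_p i x"
    using assms by (simp add: if_distrib[of "\<lambda>c. _ * c"] cong: if_cong)
  finally show ?thesis .
qed

definition cheb_space :: "nat \<Rightarrow> (real \<Rightarrow> real) set" where
  "cheb_space L = fun_space.span (cheb_p ` {..<L})"

lemma cheb_space_induct [consumes 1, case_names zero add scale cheb_p]:
  assumes "f \<in> cheb_space L"
    and "P (\<lambda>x. 0)"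
    and "\<And>f g. P f \<Longrightarrow> P g \<Longrightarrow> P (\<lambda>x. f x + g x)"
    and "\<And>c f. P f \<Longrightarrow> P (\<lambda>x. c * f x)"
    and "\<And>i. i < L \<Longrightarrow> P (cheb_p i)"
  shows "P f"
proof -
  have "f \<in> Collect P"
    using assms(1) unfolding cheb_space_def
  proof (induction rule: fun_space.span_induct_alt)
    case base
    then show ?case using assms(2) by (simp add: zero_fun_def)
  next
    case (step c x y)
    then obtain i where "i < L" "x = cheb_p i" by auto
    then show ?case
      using step assms(3)[of "\<lambda>z. c * x z" y] assms(4,5) by (simp add: plus_fun_def)
  qed
  then show ?thesis by simp
qed

lemma cheb_space_cheb_p: "i < L \<Longrightarrow> cheb_p i \<in> cheb_space L"
  unfolding cheb_space_def by (rule fun_space.span_base) auto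

lemma cheb_space_scale: "f \<in> cheb_space L \<Longrightarrow> (\<lambda>x. c * f x) \<in> cheb_space L"
  unfolding cheb_space_def by (rule fun_space.span_scale)

lemma sum_fun_eq: "(\<Sum>i\<in>I. f i) = (\<lambda>x. \<Sum>i\<in>I. f i x :: real)"
  by (induction I rule: infinite_finite_induct) (auto simp: fun_eq_iff)

lemma fun_span_sum:
  assumes "\<And>i. i \<in> I \<Longrightarrow> f i \<in> fun_space.span B"
  shows "(\<lambda>x. \<Sum>i\<in>I. f i x) \<in> fun_space.span B"
  using fun_space.span_sum[of I f B] assms by (simp add: sum_fun_eq)

lemma cheb_space_sum:
  assumes "\<And>i. i \<in> I \<Longrightarrow> f i \<in> cheb_space L"
  shows "(\<lambda>x. \<Sum>i\<in>I. f i x) \<in> cheb_space L"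
  using assms unfolding cheb_space_def by (rule fun_span_sum)

lemma cheb_space_K_kernel:
  assumes "r < L" shows "K_kernel r x \<in> cheb_space L"
proof -
  have "K_kernel r x = (\<lambda>y. \<Sum>s=0..r. cheb_p s x * cheb_p s y)"
    by (simp add: K_kernel_def fun_eq_iff)
  then show ?thesis
    using assms by (auto intro!: cheb_space_sum cheb_space_scale cheb_space_cheb_p)
qed

lemma cheb_space_v_kernel:
  assumes "0 < m" "N + m \<le> L" shows "v_kernel N m x \<in> cheb_space L"
proof -
  have "v_kernel N m x = (\<lambda>y. 1 / (2 * real m) * (\<Sum>r=N-m..N+m-1. K_kernel r x y))"
    by (simp add: v_kernel_def fun_eq_iff)
  then show ?thesis
    by (simp only:) (intro cheb_space_scale cheb_space_sum cheb_space_K_kernel, use assms in auto)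
qed

lemma cheb_space_Phi:
  assumes "0 < m" "N + m \<le> L" shows "Phi N m x \<in> cheb_space L"
proof -
  have "Phi N m x = (\<lambda>y. pi / real N * v_kernel N m x y)"
    by (simp add: Phi_def fun_eq_iff)
  then show ?thesis
    by (simp only: cheb_space_scale[OF cheb_space_v_kernel[OF assms]])
qed

lemma continuous_on_cheb_space:
  assumes "f \<in> cheb_space L" shows "cont f"
  using assms by (induction rule: cheb_space_induct) (auto intro: continuous_intros)

lemma K_kernel_reproduces:
  assumes "f \<in> cheb_space L" "L \<le> Suc r"
  shows "cheb_integral (\<lambda>y. f y * K_kernel r x y) = f x"
proof -
  have "cont f \<and> cheb_integral (\<lambda>y. f y * K_kernel r x y) = f x"
    using assms(1)
  proof (induction rule: cheb_space_induct)
    case zero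
    then show ?case by (simp add: cheb_integral_def)
  next
    case (add f g)
    then have "cont (\<lambda>y. f y * K_kernel r x y)" "cont (\<lambda>y. g y * K_kernel r x y)"
      by (auto intro!: continuous_on_mult continuous_on_K_kernel)
    from cheb_integral_add[OF this] add show ?case
      by (auto simp: distrib_right intro: continuous_on_add)
  next
    case (scale c f)
    then show ?case
      by (auto simp: mult.assoc cheb_integral_cmult intro!: continuous_intros)
  next
    case (cheb_p i)
    then show ?case
      using K_kernel_reproduces_cheb_p[of i r x] assms(2) continuous_on_cheb_p by auto
  qed
  then show ?thesis by simp
qed

text \<open>All indices in the window are at least \<open>N - m\<close>, so every kernel of the mean
  already fixes functions of degree at most \<open>N - m\<close>.\<close>

lemma v_kernel_reproduces:
  assumes "0 < m" "m < N" "f \<in> cheb_space L" "L \<le> Suc (N - m)"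
  shows "cheb_integral (\<lambda>y. f y * v_kernel N m x y) = f x"
proof -
  have c: "cont f" by (rule continuous_on_cheb_space[OF assms(3)])
  have "cheb_integral (\<lambda>y. f y * v_kernel N m x y) =
      cheb_integral (\<lambda>y. 1 / (2 * real m) * (\<Sum>r=N-m..N+m-1. f y * K_kernel r x y))"
    by (rule cheb_integral_cong) (simp add: v_kernel_def sum_distrib_left)
  also have "\<dots> = 1 / (2 * real m) * (\<Sum>r=N-m..N+m-1. cheb_integral (\<lambda>y. f y * K_kernel r x y))"
    unfolding cheb_integral_cmult
    by (subst cheb_integral_sum) (auto intro!: continuous_intros c)
  also have "\<dots> = 1 / (2 * real m) * (\<Sum>r=N-m..N+m-1. f x)"
    using assms by (intro arg_cong2[where f="(*)"] refl sum.cong K_kernel_reproduces[OF assms(3)]) auto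
  also have "\<dots> = f x"
    using assms by simp
  finally show ?thesis .
qed

lemma Phi_reproduces:
  assumes "0 < m" "m < N" "f \<in> cheb_space L" "L \<le> Suc (N - m)"
  shows "cheb_integral (\<lambda>y. f y * Phi N m x y) = pi / real N * f x"
proof -
  have "cheb_integral (\<lambda>y. f y * Phi N m x y) = cheb_integral (\<lambda>y. pi / real N * (f y * v_kernel N m x y))"
    by (rule cheb_integral_cong) (simp add: Phi_def)
  then show ?thesis
    using v_kernel_reproduces[OF assms] by (simp only: cheb_integral_cmult)
qed

lemma cheb_integral_K_kernel:
  assumes "x \<in> {-1..1}" shows "cheb_integral (K_kernel r x) = 1"
proof -
  have "sqrt (1 / pi) * cheb_integral (K_kernel r x) = cheb_integral (\<lambda>y. sqrt (1 / pi) * K_kernel r x y)"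
    by (simp only: cheb_integral_cmult)
  also have "\<dots> = cheb_integral (\<lambda>y. cheb_p 0 y * K_kernel r x y)"
    by (rule cheb_integral_cong) (auto simp: cheb_p_def abs_le_iff)
  also have "\<dots> = sqrt (1 / pi) * 1"
    using assms by (simp add: K_kernel_reproduces_cheb_p) (auto simp: cheb_p_def abs_le_iff)
  finally show ?thesis
    by (subst (asm) mult_cancel_left) auto
qed

lemma cheb_integral_abs_v_kernel_le:
  assumes "0 < m" "m < N" "x \<in> {-1..1}"
  shows "cheb_integral (\<lambda>y. \<bar>v_kernel N m x y\<bar>) \<le> 18 * (1 + ln (real N / real m))"
proof -
  obtain a where a: "0 \<le> a" "a \<le> pi" "x = cos a"
    using obtain_angle[OF assms(3)] .
  define B where "B u = real N / ((1 + real N * u) * (1 + real m * u))" for u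
  \<comment> \<open>The antiderivative of \<open>B\<close> vanishing at 0, found by partial
    fractions.\<close>
  define G where "G u = real N / (real N - real m) * (ln (1 + real N * u) - ln (1 + real m * u))" for u
  define l where "l = ln (real N / real m)"
  have pos: "0 < 1 + real k * u" if "0 \<le> u" for k u
    using that by (simp add: add_pos_nonneg)
  have G': "(G has_real_derivative B u) (at u)" if "0 \<le> u" for u
  proof -
    have "real N / (real N - real m) *
        (real N / (1 + real N * u) - real m / (1 + real m * u)) = B u"
    proof -
      have "real N / (1 + real N * u) - real m / (1 + real m * u) =
          (real N - real m) / ((1 + real N * u) * (1 + real m * u))"
        using pos[OF that, of N] pos[OF that, of m] by (subst diff_frac_eq) (auto simp: algebra_simps)
      then show ?thesis
        using assms by (simp add: B_def)
    qed
    moreover have "((\<lambda>u. ln (1 + real k * u)) has_real_derivative real k / (1 + real k * u)) (at u)" for k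
      using pos[OF that, of k] by (auto intro!: derivative_eq_intros)
    then have "(G has_real_derivative real N / (real N - real m) *
        (real N / (1 + real N * u) - real m / (1 + real m * u))) (at u)"
      unfolding G_def by (intro DERIV_cmult DERIV_diff)
    ultimately show ?thesis by simp
  qed
  have G0: "G 0 = 0" by (simp add: G_def)
  \<comment> \<open>The prefactor \<open>N / (N - m)\<close> grows as \<open>m\<close> approaches
    \<open>N\<close>, but then \<open>l\<close> is small: with \<open>y = N / m\<close>, the bound
    \<open>ln y \<le> y - 1\<close> turns \<open>y / (y - 1) * ln y\<close> into at most
    \<open>1 + ln y\<close>.\<close>
  have Gle: "G u \<le> 1 + l" if "0 \<le> u" for u
  proof -
    define y where "y = real N / real m"
    have y: "1 < y" using assms by (simp add: y_def)
    have "ln (1 + real N * u) - ln (1 + real m * u) = ln ((1 + real N * u) / (1 + real m * u))"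
      using pos[OF that, of N] pos[OF that, of m] by (subst ln_div) auto
    also have "\<dots> \<le> ln (real N / real m)"
      using pos[OF that, of N] pos[OF that, of m] assms that
      by (intro ln_mono divide_pos_pos) (auto simp: divide_le_eq pos_le_divide_eq field_simps)
    finally have "G u \<le> real N / (real N - real m) * l"
      unfolding G_def l_def using assms by (intro mult_left_mono) auto
    also have "real N / (real N - real m) = y / (y - 1)"
      using assms by (simp add: y_def field_simps)
    also have "y / (y - 1) * l \<le> 1 + l"
    proof -
      have "l \<le> y - 1"
        unfolding l_def y_def[symmetric] using y by (intro ln_le_minus_one) auto
      then have "y * l \<le> (1 + l) * (y - 1)"
        by (simp add: algebra_simps)
      then show ?thesis using y by (simp add: field_simps)
    qed
    finally show ?thesis .
  qed
  \<comment> \<open>The absolute value is resolved by splitting at \<open>a\<close>. Each half is at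
    most \<open>1 + l\<close>, so the constant 9 of \<open>v_kernel_bound\<close> becomes
    18.\<close>
  have "((\<lambda>t. B \<bar>a - t\<bar>) has_integral (- G (a - a) - - G (a - 0))) {0..a}"
  proof (rule fundamental_theorem_of_calculus)
    fix t assume t: "t \<in> {0..a}"
    have "((\<lambda>t. G (a - t)) has_real_derivative B (a - t) * (- 1)) (at t)"
      by (rule DERIV_chain2[OF G']) (use t in \<open>auto intro!: derivative_eq_intros\<close>)
    from has_field_derivative_at_within[OF DERIV_minus[OF this], of "{0..a}"]
    have "((\<lambda>t. - G (a - t)) has_real_derivative B \<bar>a - t\<bar>) (at t within {0..a})"
      using t by simp
    then show "((\<lambda>t. - G (a - t)) has_vector_derivative B \<bar>a - t\<bar>) (at t within {0..a})"
      by (simp only: has_real_derivative_iff_has_vector_derivative)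
  qed (use a in auto)
  moreover have "((\<lambda>t. B \<bar>a - t\<bar>) has_integral (G (pi - a) - G (a - a))) {a..pi}"
  proof (rule fundamental_theorem_of_calculus)
    fix t assume t: "t \<in> {a..pi}"
    have "((\<lambda>t. G (t - a)) has_real_derivative B (t - a) * 1) (at t)"
      by (rule DERIV_chain2[OF G']) (use t in \<open>auto intro!: derivative_eq_intros\<close>)
    from has_field_derivative_at_within[OF this, of "{a..pi}"]
    have "((\<lambda>t. G (t - a)) has_real_derivative B \<bar>a - t\<bar>) (at t within {a..pi})"
      using t by simp
    then show "((\<lambda>t. G (t - a)) has_vector_derivative B \<bar>a - t\<bar>) (at t within {a..pi})"
      by (simp only: has_real_derivative_iff_has_vector_derivative)
  qed (use a in auto)
  ultimately have "((\<lambda>t. B \<bar>a - t\<bar>) has_integral (G a + G (pi - a))) {0..pi}"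
    using has_integral_combine[OF a(1,2)] G0 by fastforce
  from has_integral_mult_right[OF this, of 9]
  have I: "((\<lambda>t. 9 * B \<bar>a - t\<bar>) has_integral (9 * (G a + G (pi - a)))) {0..pi}" .
  have "cheb_integral (\<lambda>y. \<bar>v_kernel N m x y\<bar>) \<le> 9 * (G a + G (pi - a))"
    unfolding cheb_integral_def
  proof (rule has_integral_le[OF integrable_integral I])
    show "(\<lambda>t. \<bar>v_kernel N m x (cos t)\<bar>) integrable_on {0..pi}"
      by (rule integrable_comp_cos) (intro continuous_intros)
    show "\<bar>v_kernel N m x (cos t)\<bar> \<le> 9 * B \<bar>a - t\<bar>" if "t \<in> {0..pi}" for t
      using v_kernel_bound[OF assms(1,2) a(1,2)] that by (simp add: a(3) B_def)
  qed
  also have "\<dots> \<le> 9 * ((1 + l) + (1 + l))"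
    using a by (intro mult_left_mono add_mono Gle) auto
  finally show ?thesis by (simp add: l_def)
qed

section \<open>The Marcinkiewicz inequality\<close>

text \<open>Convexity: the tangent at \<open>c\<close> lies below the graph. It follows from Young's
  inequality with conjugate exponent \<open>q\<close>; \<open>p = 1\<close>, where \<open>q\<close>
  would be infinite, is separate.\<close>

lemma powr_tangent_le:
  fixes c h p :: real
  assumes "1 \<le> p" "0 < c" "0 \<le> h"
  shows "c powr p + p * c powr (p - 1) * (h - c) \<le> h powr p"
proof (cases "p = 1")
  case False
  define q where "q = p / (p - 1)"
  have p: "1 < p" using assms False by simp
  have cp: "c powr p = c * c powr (p - 1)"
    using assms by (simp add: powr_mult_base)
  have "h * c powr (p - 1) \<le> h powr p / p + (c powr (p - 1)) powr q / q"
    using p assms by (intro Youngs_inequality) (auto simp: q_def divide_simps)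
  also have "(c powr (p - 1)) powr q = c powr p"
    using p by (simp add: powr_powr q_def)
  finally have "p * (h * c powr (p - 1)) \<le> p * (h powr p / p + c powr p / q)"
    using p by (intro mult_left_mono) auto
  also have "\<dots> = h powr p + (p - 1) * c powr p"
    using p by (simp add: q_def field_simps)
  finally show ?thesis
    by (simp add: cp algebra_simps)
qed (use assms in simp)

text \<open>The arithmetic shared by the two Jensen inequalities below. For a weight of mass
  \<open>B\<close> and weighted total \<open>A\<close>, the bracket is the integral of the tangent
  at \<open>c = A / \<Lambda>\<close>. Placing the tangent there rather than at the mean
  \<open>A / B\<close> makes an upper bound on the mass sufficient: the excess
  \<open>(p - 1) * c powr p * (\<Lambda> - B)\<close> is nonnegative.\<close>

lemma powr_tangent_total:
  fixes A B \<Lambda> p :: real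
  assumes "1 \<le> p" "0 < A" "0 < \<Lambda>" "B \<le> \<Lambda>"
  defines "c \<equiv> A / \<Lambda>"
  shows "A powr p \<le> \<Lambda> powr (p - 1) * (c powr p * B + p * c powr (p - 1) * (A - c * B))"
proof -
  have c: "0 < c" "A = c * \<Lambda>"
    using assms by (auto simp: c_def)
  have cp: "c powr p = c * c powr (p - 1)"
    using c by (simp add: powr_mult_base)
  have Lp: "\<Lambda> powr p = \<Lambda> * \<Lambda> powr (p - 1)"
    using assms by (simp add: powr_mult_base)
  have "c powr p * \<Lambda> \<le> c powr p * \<Lambda> + (p - 1) * (c powr p * (\<Lambda> - B))"
    using assms by auto
  also have "\<dots> = c powr p * B + p * c powr (p - 1) * (A - c * B)"
    by (simp add: cp c(2) algebra_simps)
  finally have "\<Lambda> powr (p - 1) * (c powr p * \<Lambda>) \<le>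
      \<Lambda> powr (p - 1) * (c powr p * B + p * c powr (p - 1) * (A - c * B))"
    by (intro mult_left_mono) auto
  moreover have "A powr p = \<Lambda> powr (p - 1) * (c powr p * \<Lambda>)"
    unfolding c(2) using c(1) assms(3) by (simp add: powr_mult Lp)
  ultimately show ?thesis by simp
qed

lemma jensen_sum:
  fixes f g :: "'a \<Rightarrow> real"
  assumes "1 \<le> p" "0 < \<Lambda>" "finite I"
    and nonneg: "\<And>i. i \<in> I \<Longrightarrow> 0 \<le> f i" "\<And>i. i \<in> I \<Longrightarrow> 0 \<le> g i"
    and total: "(\<Sum>i\<in>I. g i) \<le> \<Lambda>"
  shows "(\<Sum>i\<in>I. f i * g i) powr p \<le> \<Lambda> powr (p - 1) * (\<Sum>i\<in>I. f i powr p * g i)"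
proof -
  define A where "A = (\<Sum>i\<in>I. f i * g i)"
  define B where "B = (\<Sum>i\<in>I. g i)"
  define c where "c = A / \<Lambda>"
  have "0 \<le> A" unfolding A_def by (intro sum_nonneg mult_nonneg_nonneg nonneg)
  \<comment> \<open>The tangent is available only for \<open>c > 0\<close>.\<close>
  then consider "A = 0" | "0 < A" by linarith
  then have "A powr p \<le> \<Lambda> powr (p - 1) * (\<Sum>i\<in>I. f i powr p * g i)"
  proof cases
    case 1
    then show ?thesis by (auto intro!: mult_nonneg_nonneg sum_nonneg nonneg)
  next
    case 2
    have "A powr p \<le> \<Lambda> powr (p - 1) * (c powr p * B + p * c powr (p - 1) * (A - c * B))"
      unfolding c_def using assms 2 by (intro powr_tangent_total) (auto simp: B_def)
    also have "c powr p * B + p * c powr (p - 1) * (A - c * B) =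
        (c powr p - p * c powr (p - 1) * c) * B + p * c powr (p - 1) * A"
      by (simp add: algebra_simps)
    also have "\<dots> = (\<Sum>i\<in>I. (c powr p + p * c powr (p - 1) * (f i - c)) * g i)"
      unfolding A_def B_def sum_distrib_left sum.distrib[symmetric]
      by (rule sum.cong) (simp_all add: algebra_simps)
    also have "\<dots> \<le> (\<Sum>i\<in>I. f i powr p * g i)"
      using assms 2 by (intro sum_mono mult_right_mono powr_tangent_le nonneg) (auto simp: c_def)
    finally show ?thesis
      by (simp add: mult_left_mono)
  qed
  then show ?thesis by (simp add: A_def)
qed

lemma cont_abs_powr:
  assumes "cont f" "1 \<le> p" shows "cont (\<lambda>x. \<bar>f x\<bar> powr p)"
  using assms by (intro continuous_on_powr' continuous_intros) auto

lemma jensen_cheb_integral: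
  assumes "1 \<le> p" "0 < \<Lambda>" "cont f" "cont g"
    and nonneg: "\<And>x. x \<in> {-1..1} \<Longrightarrow> 0 \<le> g x"
    and total: "cheb_integral g \<le> \<Lambda>"
  shows "cheb_integral (\<lambda>x. \<bar>f x\<bar> * g x) powr p \<le>
    \<Lambda> powr (p - 1) * cheb_integral (\<lambda>x. \<bar>f x\<bar> powr p * g x)"
proof -
  define A where "A = cheb_integral (\<lambda>x. \<bar>f x\<bar> * g x)"
  define B where "B = cheb_integral g"
  define c where "c = A / \<Lambda>"
  note cts = continuous_intros assms(3,4) cont_abs_powr[OF assms(3,1)]
  have "0 \<le> A" unfolding A_def
    by (intro cheb_integral_nonneg mult_nonneg_nonneg nonneg cts) auto
  then consider "A = 0" | "0 < A" by linarith
  then have "A powr p \<le> \<Lambda> powr (p - 1) * cheb_integral (\<lambda>x. \<bar>f x\<bar> powr p * g x)"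
  proof cases
    case 1
    have "0 \<le> cheb_integral (\<lambda>x. \<bar>f x\<bar> powr p * g x)"
      by (intro cheb_integral_nonneg mult_nonneg_nonneg nonneg cts) auto
    then show ?thesis using 1 by simp
  next
    case 2
    define d where "d = p * c powr (p - 1)"
    have "A powr p \<le> \<Lambda> powr (p - 1) * (c powr p * B + p * c powr (p - 1) * (A - c * B))"
      unfolding c_def using assms 2 by (intro powr_tangent_total) (auto simp: B_def)
    also have "c powr p * B + p * c powr (p - 1) * (A - c * B) =
        (c powr p - d * c) * B + d * A"
      by (simp add: d_def algebra_simps)
    also have "\<dots> = cheb_integral (\<lambda>x. (c powr p - d * c) * g x + d * (\<bar>f x\<bar> * g x))"
      unfolding A_def B_def
      by (subst cheb_integral_add) (simp_all only: cheb_integral_cmult, (intro cts)+)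
    also have "\<dots> \<le> cheb_integral (\<lambda>x. \<bar>f x\<bar> powr p * g x)"
    proof (rule cheb_integral_mono)
      fix x :: real assume x: "x \<in> {-1..1}"
      have "(c powr p + p * c powr (p - 1) * (\<bar>f x\<bar> - c)) * g x \<le> \<bar>f x\<bar> powr p * g x"
        using assms 2 x by (intro mult_right_mono powr_tangent_le nonneg) (auto simp: c_def)
      then show "(c powr p - d * c) * g x + d * (\<bar>f x\<bar> * g x) \<le> \<bar>f x\<bar> powr p * g x"
        by (simp add: d_def algebra_simps)
    qed (intro cts)+
    finally show ?thesis
      by (simp add: mult_left_mono)
  qed
  then show ?thesis by (simp add: A_def)
qed

text \<open>With \<open>L = 2 * N\<close>, the mean of \<open>K_kernel r\<close> over
  \<open>L \<le> r < 2 * L\<close> reproduces \<open>f\<close> and is dominated by \<open>G\<close>,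
  whose integral is 2 + 1 and whose node sums are at most 3 * (2 + 1). Jensen with mass 3 gives
  \<open>3 powr (p - 1)\<close> at each point, and summation over the nodes gives the factor
  9.\<close>

lemma marcinkiewicz_nodes:
  assumes "0 < N" "f \<in> cheb_space (2 * N)" "1 \<le> p"
  shows "pi / real N * (\<Sum>k=1..N. \<bar>f (cheb_node N k)\<bar> powr p) \<le>
    9 powr p * cheb_integral (\<lambda>x. \<bar>f x\<bar> powr p)"
proof -
  define L where "L = 2 * N"
  define S where "S M x y = (\<Sum>r<M. K_kernel r x y)" for M x y
  \<comment> \<open>A de la Vallee Poussin mean is a difference of two nonnegative Fejer sums; the kernel
    \<open>G\<close> replaces the difference by a sum.\<close>
  define G where "G x y = 1 / real L * (S (2 * L) x y + S L x y)" for x y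
  have L: "0 < L" using assms by (simp add: L_def)
  have f: "cont f" by (rule continuous_on_cheb_space[OF assms(2)])
  note cts = continuous_intros f cont_abs_powr[OF f assms(3)]
  have cS: "cont (S M x)" for M x
    unfolding S_def by (intro continuous_intros)
  have cG: "cont (G x)" for x
    unfolding G_def by (intro continuous_intros cS)
  have S0: "0 \<le> S M x y" if "x \<in> {-1..1}" "y \<in> {-1..1}" for M x y
    unfolding S_def by (rule sum_K_kernel_nonneg[OF that])
  have G0: "0 \<le> G x y" if "x \<in> {-1..1}" "y \<in> {-1..1}" for x y
    unfolding G_def using S0[OF that] by simp
  have intS: "cheb_integral (S M x) = real M" if "x \<in> {-1..1}" for M x
  proof -
    have "cheb_integral (S M x) = (\<Sum>r<M. cheb_integral (K_kernel r x))"
      unfolding S_def by (rule cheb_integral_sum) (auto intro: continuous_on_K_kernel)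
    then show ?thesis using that by (simp add: cheb_integral_K_kernel)
  qed
  have intG: "cheb_integral (G x) \<le> 3" if "x \<in> {-1..1}" for x
  proof -
    have "cheb_integral (G x) = 1 / real L * (cheb_integral (S (2 * L) x) + cheb_integral (S L x))"
      unfolding G_def cheb_integral_cmult by (simp only: cheb_integral_add[OF cS cS])
    then show ?thesis using L that by (simp add: intS)
  qed
  have sumS: "pi / real N * (\<Sum>k=1..N. S M (cheb_node N k) x) \<le> 3 * real M"
    if "M \<le> 2 * L" "x \<in> {-1..1}" for M x
  proof -
    have "pi / real N * (\<Sum>k=1..N. S M (cheb_node N k) x) =
        (\<Sum>r<M. pi / real N * (\<Sum>k=1..N. K_kernel r (cheb_node N k) x))"
      unfolding S_def sum_distrib_left by (rule sum.swap)
    also have "\<dots> \<le> (\<Sum>r<M. 3)"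
      using that by (intro sum_mono sum_nodes_K_kernel_le) (auto simp: L_def)
    finally show ?thesis by simp
  qed
  have sumG: "pi / real N * (\<Sum>k=1..N. G (cheb_node N k) x) \<le> 9" if "x \<in> {-1..1}" for x
  proof -
    have "pi / real N * (\<Sum>k=1..N. G (cheb_node N k) x) = 1 / real L *
        (pi / real N * (\<Sum>k=1..N. S (2 * L) (cheb_node N k) x) +
         pi / real N * (\<Sum>k=1..N. S L (cheb_node N k) x))"
      unfolding G_def sum_distrib_left[symmetric] sum.distrib by (simp add: algebra_simps)
    also have "\<dots> \<le> 1 / real L * (3 * real (2 * L) + 3 * real L)"
      using that by (intro mult_left_mono add_mono sumS) auto
    finally show ?thesis using L by simp
  qed
  have point: "\<bar>f x\<bar> powr p \<le> 3 powr (p - 1) * cheb_integral (\<lambda>y. \<bar>f y\<bar> powr p * G x y)"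
    if x: "x \<in> {-1..1}" for x
  proof -
    have split: "S (2 * L) x y = S L x y + (\<Sum>r=L..<2*L. K_kernel r x y)" for y
      unfolding S_def lessThan_atLeast0 by (rule sum.atLeastLessThan_concat[symmetric]) auto
    have "cheb_integral (\<lambda>y. f y * (1 / real L * (S (2 * L) x y - S L x y))) =
        cheb_integral (\<lambda>y. 1 / real L * (\<Sum>r=L..<2*L. f y * K_kernel r x y))"
      by (rule cheb_integral_cong) (simp add: split sum_distrib_left)
    also have "\<dots> = 1 / real L * (\<Sum>r=L..<2*L. cheb_integral (\<lambda>y. f y * K_kernel r x y))"
      unfolding cheb_integral_cmult
      by (subst cheb_integral_sum) (auto intro!: continuous_on_mult f continuous_on_K_kernel)
    also have "\<dots> = 1 / real L * (\<Sum>r=L..<2*L. f x)"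
      by (intro arg_cong2[where f="(*)"] refl sum.cong K_kernel_reproduces[OF assms(2)])
        (auto simp: L_def)
    also have "\<dots> = f x"
      using L by simp
    finally have "f x = cheb_integral (\<lambda>y. f y * (1 / real L * (S (2 * L) x y - S L x y)))" ..
    also have "\<bar>\<dots>\<bar> \<le> cheb_integral (\<lambda>y. \<bar>f y\<bar> * G x y)"
    proof (rule abs_cheb_integral_le)
      fix y :: real assume y: "y \<in> {-1..1}"
      have "\<bar>1 / real L * (S (2 * L) x y - S L x y)\<bar> \<le> G x y"
        unfolding G_def abs_mult
        using S0[OF x y, of "2 * L"] S0[OF x y, of L] by (intro mult_mono) auto
      then show "\<bar>f y * (1 / real L * (S (2 * L) x y - S L x y))\<bar> \<le> \<bar>f y\<bar> * G x y"
        unfolding abs_mult[of "f y"] by (rule mult_left_mono) simp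
    qed (intro cts cS cG)+
    finally have "\<bar>f x\<bar> powr p \<le> cheb_integral (\<lambda>y. \<bar>f y\<bar> * G x y) powr p"
      using assms(3) by (intro powr_mono2) auto
    also have "\<dots> \<le> 3 powr (p - 1) * cheb_integral (\<lambda>y. \<bar>f y\<bar> powr p * G x y)"
      using x by (intro jensen_cheb_integral assms f cG G0 intG) auto
    finally show ?thesis .
  qed
  have "pi / real N * (\<Sum>k=1..N. \<bar>f (cheb_node N k)\<bar> powr p) \<le>
      pi / real N * (\<Sum>k=1..N. 3 powr (p - 1) * cheb_integral (\<lambda>y. \<bar>f y\<bar> powr p * G (cheb_node N k) y))"
    by (intro mult_left_mono sum_mono point cheb_node_mem) auto
  also have "\<dots> = 3 powr (p - 1) *
      cheb_integral (\<lambda>y. pi / real N * (\<Sum>k=1..N. \<bar>f y\<bar> powr p * G (cheb_node N k) y))"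
  proof -
    have "cheb_integral (\<lambda>y. \<Sum>k=1..N. \<bar>f y\<bar> powr p * G (cheb_node N k) y) =
        (\<Sum>k=1..N. cheb_integral (\<lambda>y. \<bar>f y\<bar> powr p * G (cheb_node N k) y))"
      by (rule cheb_integral_sum) (simp, intro cts cG)
    then show ?thesis
      unfolding cheb_integral_cmult sum_distrib_left[symmetric] by (simp only: mult_ac)
  qed
  also have "\<dots> \<le> 3 powr (p - 1) * cheb_integral (\<lambda>y. 9 * \<bar>f y\<bar> powr p)"
  proof (intro mult_left_mono cheb_integral_mono)
    fix y :: real assume "y \<in> {-1..1}"
    from mult_left_mono[OF sumG[OF this], of "\<bar>f y\<bar> powr p"]
    show "pi / real N * (\<Sum>k=1..N. \<bar>f y\<bar> powr p * G (cheb_node N k) y) \<le> 9 * \<bar>f y\<bar> powr p"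
      unfolding sum_distrib_left[symmetric] by (simp only: mult_ac) simp
  qed (intro cts cG | simp)+
  \<comment> \<open>Enlarging 3 to 9 makes the constant a pure p-th power, whose p-th root does not
    depend on \<open>p\<close>.\<close>
  also have "\<dots> \<le> 9 powr (p - 1) * cheb_integral (\<lambda>y. 9 * \<bar>f y\<bar> powr p)"
    using assms(3) by (intro mult_right_mono powr_mono2 cheb_integral_nonneg cts) auto
  also have "\<dots> = 9 powr p * cheb_integral (\<lambda>y. \<bar>f y\<bar> powr p)"
    unfolding cheb_integral_cmult using powr_mult_base[of 9 "p - 1"] by simp
  finally show ?thesis .
qed

section \<open>The wavelet space\<close>

lemma cheb_space_Phi_expand:
  assumes "0 < m" "m < N" "f \<in> cheb_space L" "L \<le> Suc (N - m)"
  shows "f x = (\<Sum>h=1..N. f (cheb_node N h) * Phi N m (cheb_node N h) x)"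
  using assms(3)
proof (induction rule: cheb_space_induct)
  case (add f g)
  then show ?case by (simp add: distrib_right sum.distrib)
next
  case (scale c f)
  then show ?case by (simp add: mult.assoc flip: sum_distrib_left)
next
  case (cheb_p i)
  then show ?case using assms by (intro cheb_p_Phi_expand) auto
qed simp

text \<open>The three-term recurrence \<open>2 * cos t * cos (i * t) = cos ((i + 1) * t) + cos ((i -
  1) * t)\<close>; the coefficients \<open>a\<close> and \<open>b\<close> adjust the
  normalizations.\<close>

lemma cheb_space_times_id:
  assumes "f \<in> cheb_space L"
  shows "\<exists>g\<in>cheb_space (Suc L). \<forall>x\<in>{-1..1}. g x = x * f x"
  using assms
proof (induction rule: cheb_space_induct)
  case zero
  show ?case
    by (rule bexI[of _ "\<lambda>x. 0"]) (use cheb_space_sum[of "{}"] in simp_all)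
next
  case (add f1 f2)
  then obtain g1 g2 where g: "g1 \<in> cheb_space (Suc L)" "g2 \<in> cheb_space (Suc L)"
    "\<forall>x\<in>{-1..1}. g1 x = x * f1 x" "\<forall>x\<in>{-1..1}. g2 x = x * f2 x" by blast
  then have "g1 + g2 \<in> cheb_space (Suc L)"
    unfolding cheb_space_def by (intro fun_space.span_add)
  then show ?case
    using g(3,4) by (intro bexI[of _ "g1 + g2"]) (simp_all add: distrib_left)
next
  case (scale c f1)
  then obtain g1 where g: "g1 \<in> cheb_space (Suc L)" "\<forall>x\<in>{-1..1}. g1 x = x * f1 x" by blast
  then show ?case
    using cheb_space_scale[OF g(1), of c] by (intro bexI[of _ "\<lambda>x. c * g1 x"]) simp_all
next
  case (cheb_p i)
  have const: "cheb_const j \<noteq> 0" for j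
    by (simp add: cheb_const_def)
  define a where "a = cheb_const i / (2 * cheb_const (Suc i))"
  \<comment> \<open>For \<open>i = 0\<close> the lower neighbour is
    \<open>cos (- t) = cos t\<close>, of index 1, whereas natural subtraction would give 0.\<close>
  define j where "j = (if i = 0 then 1 else i - 1)"
  define b where "b = cheb_const i / (2 * cheb_const j)"
  have "(\<lambda>x. a * cheb_p (Suc i) x) + (\<lambda>x. b * cheb_p j x) \<in> cheb_space (Suc L)"
    unfolding cheb_space_def using cheb_p
    by (intro fun_space.span_add fun_space.span_scale fun_space.span_base) (auto simp: j_def)
  moreover have "a * cheb_p (Suc i) x + b * cheb_p j x = x * cheb_p i x" if x: "x \<in> {-1..1}" for x
  proof -
    obtain t where t: "x = cos t" by (rule obtain_angle[OF x])
    have "cos (real j * t) = cos (real i * t - t)"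
      by (cases "i = 0") (auto simp: j_def of_nat_diff algebra_simps)
    moreover have "cos (real (Suc i) * t) = cos (real i * t + t)"
      by (simp add: algebra_simps)
    ultimately have "cos (real (Suc i) * t) + cos (real j * t) = 2 * (cos t * cos (real i * t))"
      by (simp add: cos_add cos_diff)
    moreover have "a * cheb_p (Suc i) x + b * cheb_p j x =
        cheb_const i / 2 * (cos (real (Suc i) * t) + cos (real j * t))"
      using const[of j] const[of "Suc i"]
      by (simp add: t cheb_p_cos a_def b_def distrib_left del: of_nat_Suc)
    ultimately show ?thesis
      by (simp add: t cheb_p_cos)
  qed
  ultimately show ?case
    by (intro bexI[of _ "(\<lambda>x. a * cheb_p (Suc i) x) + (\<lambda>x. b * cheb_p j x)"]) simp_all
qed

text \<open>Agreement is confined to \<open>[-1, 1]\<close>, since members of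
  \<open>cheb_space\<close> vanish outside and powers do not.\<close>

lemma cheb_space_power: "\<exists>g\<in>cheb_space (Suc s). \<forall>x\<in>{-1..1}. g x = x ^ s"
proof (induction s)
  case 0
  have "(\<lambda>x. sqrt pi * cheb_p 0 x) \<in> cheb_space (Suc 0)"
    by (intro cheb_space_scale cheb_space_cheb_p) simp
  moreover have "sqrt pi * cheb_p 0 x = 1" if "x \<in> {-1..1}" for x
    using that by (simp add: cheb_p_def abs_le_iff real_sqrt_divide)
  ultimately show ?case
    by (intro bexI[of _ "\<lambda>x. sqrt pi * cheb_p 0 x"]) simp_all
next
  case (Suc s)
  then obtain f where f: "f \<in> cheb_space (Suc s)" "\<forall>x\<in>{-1..1}. f x = x ^ s" by blast
  obtain g where "g \<in> cheb_space (Suc (Suc s))" "\<forall>x\<in>{-1..1}. g x = x * f x"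
    using cheb_space_times_id[OF f(1)] by blast
  then show ?case using f(2) by (intro bexI[of _ g]) simp_all
qed

lemma V_space_subset_cheb_space:
  assumes "0 < m" "N + m \<le> L" shows "V_space N m \<subseteq> cheb_space L"
  unfolding V_space_def cheb_space_def
proof (rule fun_space.span_minimal[OF _ fun_space.subspace_span])
  show "scaling_fun N m ` {1..N} \<subseteq> fun_space.span (cheb_p ` {..<L})"
    using cheb_space_Phi[OF assms] by (auto simp: scaling_fun_def cheb_space_def)
qed

text \<open>By linearity only generators matter, and for them the interpolation property
  \<open>Phi_nodes\<close> collapses the sum.\<close>

lemma V_space_expand:
  assumes "0 < m" "m < N" "f \<in> V_space N m"
  shows "f x = (\<Sum>h=1..N. f (cheb_node N h) * Phi N m (cheb_node N h) x)"
proof -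
  let ?P = "\<lambda>f. \<forall>x. f x = (\<Sum>h=1..N. f (cheb_node N h) * Phi N m (cheb_node N h) x)"
  have "?P f"
    using assms(3) unfolding V_space_def
  proof (induction rule: fun_space.span_induct_alt)
    case base
    then show ?case by simp
  next
    case (step c g f)
    then obtain j where j: "j \<in> {1..N}" "g = Phi N m (cheb_node N j)"
      by (auto simp: scaling_fun_def)
    have "(\<Sum>h=1..N. g (cheb_node N h) * Phi N m (cheb_node N h) x) =
        (\<Sum>h=1..N. if j = h then Phi N m (cheb_node N h) x else 0)" for x
      using j assms by (intro sum.cong refl) (simp add: Phi_nodes)
    then have "?P g"
      using j by simp
    show ?case
    proof
      fix x
      have "c * g x + f x = c * (\<Sum>h=1..N. g (cheb_node N h) * Phi N m (cheb_node N h) x) +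
          (\<Sum>h=1..N. f (cheb_node N h) * Phi N m (cheb_node N h) x)"
        using \<open>?P g\<close>[rule_format, of x] step.IH[rule_format, of x] by (rule arg_cong2[where f="\<lambda>a b. c * a + b"])
      then show "((\<lambda>x. c * g x) + f) x =
          (\<Sum>h=1..N. ((\<lambda>x. c * g x) + f) (cheb_node N h) * Phi N m (cheb_node N h) x)"
        by (simp add: distrib_right sum.distrib sum_distrib_left mult.assoc)
    qed
  qed
  then show ?thesis by blast
qed

text \<open>One computation serves the vanishing moments and the orthogonality to
  \<open>V_space n m\<close>; both kinds of \<open>g\<close> are recovered from their coarse node
  values. Pairing \<open>g\<close> with \<open>Phi (3 * n) m w\<close> gives
  \<open>pi / (3 * n) * g w\<close>, so the integral is that factor times the difference of
  \<open>g z\<close> and its own coarse expansion.\<close>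

lemma wavelet_orthogonal:
  assumes "0 < m" "m < n" "g \<in> cheb_space L" "L \<le> Suc (3 * n - m)"
    and expand: "\<And>x. g x = (\<Sum>h=1..n. g (cheb_node n h) * Phi n m (cheb_node n h) x)"
  shows "cheb_integral (\<lambda>x. g x * wavelet n m z x) = 0"
proof -
  have g: "cont g" by (rule continuous_on_cheb_space[OF assms(3)])
  have R: "cheb_integral (\<lambda>x. g x * Phi (3 * n) m w x) = pi / real (3 * n) * g w" for w
    by (rule Phi_reproduces[OF _ _ assms(3,4)]) (use assms in auto)
  have "cheb_integral (\<lambda>x. g x * wavelet n m z x) =
      cheb_integral (\<lambda>x. g x * Phi (3 * n) m z x +
        (\<Sum>h=1..n. - Phi n m (cheb_node n h) z * (g x * Phi (3 * n) m (cheb_node n h) x)))"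
    by (rule cheb_integral_cong)
      (simp add: wavelet_def scaling_fun_def right_diff_distrib sum_distrib_left sum_negf mult_ac)
  also have "\<dots> = cheb_integral (\<lambda>x. g x * Phi (3 * n) m z x) +
      cheb_integral (\<lambda>x. \<Sum>h=1..n. - Phi n m (cheb_node n h) z * (g x * Phi (3 * n) m (cheb_node n h) x))"
    by (rule cheb_integral_add) (intro continuous_intros g)+
  also have "cheb_integral (\<lambda>x. \<Sum>h=1..n. - Phi n m (cheb_node n h) z * (g x * Phi (3 * n) m (cheb_node n h) x)) =
      (\<Sum>h=1..n. cheb_integral (\<lambda>x. - Phi n m (cheb_node n h) z * (g x * Phi (3 * n) m (cheb_node n h) x)))"
    by (rule cheb_integral_sum) (simp, intro continuous_intros g)
  also have "\<dots> = (\<Sum>h=1..n. - Phi n m (cheb_node n h) z * (pi / real (3 * n) * g (cheb_node n h)))"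
    unfolding cheb_integral_cmult R ..
  also have "\<dots> = - (pi / real (3 * n) * (\<Sum>h=1..n. g (cheb_node n h) * Phi n m (cheb_node n h) z))"
    unfolding sum_distrib_left sum_negf[symmetric] by (rule sum.cong) (simp_all add: mult_ac)
  finally show ?thesis
    unfolding R expand[of z, symmetric] by simp
qed

lemma wavelet_moments:
  assumes "0 < m" "m < n" "s \<le> n - m"
  shows "(LINT x:{-1..1}|lborel. x ^ s * wavelet n m z x * weight x) = 0"
proof -
  obtain g where g: "g \<in> cheb_space (Suc s)" "\<forall>x\<in>{-1..1}. g x = x ^ s"
    using cheb_space_power by blast
  have "(LINT x:{-1..1}|lborel. x ^ s * wavelet n m z x * weight x) =
      cheb_integral (\<lambda>x. x ^ s * wavelet n m z x)"
    by (rule lborel_integral_weight) (intro continuous_intros)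
  also have "\<dots> = cheb_integral (\<lambda>x. g x * wavelet n m z x)"
    using g(2) by (intro cheb_integral_cong) auto
  also have "\<dots> = 0"
    using assms by (intro wavelet_orthogonal[OF assms(1,2) g(1)] cheb_space_Phi_expand[OF assms(1,2) g(1)]) auto
  finally show ?thesis .
qed

lemma Phi_X_nodes:
  assumes "0 < m" "m < N" "z \<in> X_nodes N" "w \<in> X_nodes N"
  shows "Phi N m z w = (if z = w then 1 else 0)"
proof -
  obtain j k where jk: "j \<in> {1..N}" "k \<in> {1..N}" "z = cheb_node N j" "w = cheb_node N k"
    using assms by (auto simp: X_nodes_def)
  have "z = w \<longleftrightarrow> j = k"
    unfolding jk(3,4) using inj_on_eq_iff[OF inj_on_cheb_node jk(1,2)] .
  then show ?thesis
    using Phi_nodes[OF assms(1,2) jk(1,2)] by (simp add: jk(3,4))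
qed

lemma cheb_node_in_X_nodes_triple: "h \<in> {1..n} \<Longrightarrow> cheb_node n h \<in> X_nodes (3 * n)"
  using X_nodes_subset_triple[of n] by (auto simp: X_nodes_def)

text \<open>The correction terms are fine kernels based at coarse nodes, hence vanish at every node
  of \<open>Y_nodes n\<close>.\<close>

lemma wavelet_Y_nodes:
  assumes "0 < m" "m < n" "z \<in> Y_nodes n" "w \<in> Y_nodes n"
  shows "wavelet n m z w = (if z = w then 1 else 0)"
proof -
  have "Phi (3 * n) m (cheb_node n h) w = 0" if h: "h \<in> {1..n}" for h
  proof -
    have "cheb_node n h \<noteq> w"
      using Y_nodesD(3)[OF assms(4)] h by (auto simp: X_nodes_def)
    then show ?thesis
      using assms h by (subst Phi_X_nodes) (auto intro: Y_nodesD cheb_node_in_X_nodes_triple)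
  qed
  moreover have "Phi (3 * n) m z w = (if z = w then 1 else 0)"
    using assms by (intro Phi_X_nodes) (auto intro: Y_nodesD)
  ultimately show ?thesis
    unfolding wavelet_def by (simp del: atLeastAtMost_iff)
qed

lemma Phi_in_V_space:
  assumes "z \<in> X_nodes N" shows "Phi N m z \<in> V_space N m"
  using assms unfolding V_space_def X_nodes_def
  by (auto simp: scaling_fun_def intro!: fun_space.span_base)

lemma wavelet_in_W_space:
  assumes "0 < m" "m < n" "z \<in> Y_nodes n"
  shows "wavelet n m z \<in> W_space n m"
proof -
  have "(\<lambda>x. \<Sum>h=1..n. scaling_fun n m h z * Phi (3 * n) m (cheb_node n h) x) \<in> V_space (3 * n) m"
    unfolding V_space_def
    by (intro fun_span_sum fun_space.span_scale Phi_in_V_space[unfolded V_space_def]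
        cheb_node_in_X_nodes_triple)
  from fun_space.span_diff[OF Phi_in_V_space[OF Y_nodesD(2)[OF assms(3)], of m, unfolded V_space_def]
      this[unfolded V_space_def]]
  have "wavelet n m z \<in> V_space (3 * n) m"
    unfolding V_space_def by (simp add: wavelet_def[abs_def] fun_diff_def)
  moreover have "inner_w (wavelet n m z) g = 0" if g: "g \<in> V_space n m" for g
  proof -
    have gc: "g \<in> cheb_space (n + m)"
      using V_space_subset_cheb_space[OF assms(1) order_refl] g by blast
    have "inner_w (wavelet n m z) g = cheb_integral (\<lambda>x. g x * wavelet n m z x)"
      using inner_w_eq[OF continuous_on_wavelet continuous_on_cheb_space[OF gc]]
      by (simp add: mult.commute)
    \<comment> \<open>Here \<open>g\<close> has degree below \<open>n + m\<close>, and
      \<open>m < n\<close> gives \<open>n + m \<le> 3 * n - m\<close>, so the fine kernel reproduces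
      it.\<close>
    also have "\<dots> = 0"
      using assms by (intro wavelet_orthogonal[OF assms(1,2) gc] V_space_expand[OF assms(1,2) g]) auto
    finally show ?thesis .
  qed
  ultimately show ?thesis
    by (simp add: W_space_def)
qed

text \<open>Orthogonality of \<open>f\<close> to a coarse scaling function, evaluated by fine
  reproduction, says that their product sums to zero over \<open>X_nodes (3 * n)\<close>. At coarse
  nodes the scaling function is a delta, so each coarse value of \<open>f\<close> is expressed by
  values on \<open>Y_nodes n\<close>. Inserting these in the fine expansion produces the formula of
  \<open>wavelet\<close>.\<close>

lemma W_space_expand:
  assumes "0 < m" "m < n" "f \<in> W_space n m" and y: "bij_betw y {1..2*n} (Y_nodes n)"
  shows "f x = (\<Sum>k=1..2*n. f (y k) * wavelet n m (y k) x)"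
proof -
  have f: "f \<in> V_space (3 * n) m" and orth: "\<And>g. g \<in> V_space n m \<Longrightarrow> inner_w f g = 0"
    using assms(3) by (auto simp: W_space_def)
  have f_expand: "f x = (\<Sum>k=1..2*n. f (y k) * Phi (3 * n) m (y k) x) +
      (\<Sum>h=1..n. f (cheb_node n h) * Phi (3 * n) m (cheb_node n h) x)" for x
    using V_space_expand[OF assms(1) _ f, of x] assms(2)
      sum_nodes_split[OF y, of "\<lambda>z. f z * Phi (3 * n) m z x"] by simp
  have fc: "cont f"
    using V_space_subset_cheb_space[OF assms(1) order_refl] f continuous_on_cheb_space by blast
  have coarse: "f (cheb_node n h) = - (\<Sum>k=1..2*n. f (y k) * Phi n m (cheb_node n h) (y k))"
    if h: "h \<in> {1..n}" for h
  proof -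
    define g where "g = Phi n m (cheb_node n h)"
    have g: "g \<in> V_space n m" "cont g"
      using Phi_in_V_space h unfolding g_def X_nodes_def by (auto intro: continuous_on_Phi)
    have gc: "g \<in> cheb_space (n + m)"
      unfolding g_def by (rule cheb_space_Phi[OF assms(1) order_refl])
    have R: "cheb_integral (\<lambda>x. g x * Phi (3 * n) m w x) = pi / real (3 * n) * g w" for w
      by (rule Phi_reproduces[OF _ _ gc]) (use assms in auto)
    have "0 = cheb_integral (\<lambda>x. f x * g x)"
      using orth[OF g(1)] inner_w_eq[OF fc g(2)] by simp
    also have "\<dots> = cheb_integral (\<lambda>x. \<Sum>k=1..3*n. f (cheb_node (3 * n) k) *
        (g x * Phi (3 * n) m (cheb_node (3 * n) k) x))"
    proof (rule cheb_integral_cong)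
      fix x
      have e: "f x = (\<Sum>k=1..3*n. f (cheb_node (3 * n) k) * Phi (3 * n) m (cheb_node (3 * n) k) x)"
        using assms by (intro V_space_expand f) auto
      show "f x * g x = (\<Sum>k=1..3*n. f (cheb_node (3 * n) k) *
          (g x * Phi (3 * n) m (cheb_node (3 * n) k) x))"
        unfolding e sum_distrib_right by (rule sum.cong) (simp_all add: mult_ac)
    qed
    also have "\<dots> = (\<Sum>k=1..3*n. cheb_integral (\<lambda>x. f (cheb_node (3 * n) k) *
        (g x * Phi (3 * n) m (cheb_node (3 * n) k) x)))"
      by (rule cheb_integral_sum) (simp, intro continuous_intros g)
    also have "\<dots> = pi / real (3 * n) * (\<Sum>k=1..3*n. f (cheb_node (3 * n) k) * g (cheb_node (3 * n) k))"
      unfolding cheb_integral_cmult R sum_distrib_left by (rule sum.cong) (simp_all add: mult_ac)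
    finally have "(\<Sum>k=1..3*n. f (cheb_node (3 * n) k) * g (cheb_node (3 * n) k)) = 0"
      using assms by simp
    then have "(\<Sum>k=1..2*n. f (y k) * g (y k)) + (\<Sum>j=1..n. f (cheb_node n j) * g (cheb_node n j)) = 0"
      using sum_nodes_split[OF y, of "\<lambda>z. f z * g z"] by simp
    moreover have "(\<Sum>j=1..n. f (cheb_node n j) * g (cheb_node n j)) =
        (\<Sum>j=1..n. if h = j then f (cheb_node n j) else 0)"
      unfolding g_def using h assms by (intro sum.cong refl) (simp add: Phi_nodes)
    ultimately show ?thesis
      using h by (simp add: g_def)
  qed
  have "(\<Sum>h=1..n. f (cheb_node n h) * Phi (3 * n) m (cheb_node n h) x) =
      (\<Sum>h=1..n. \<Sum>k=1..2*n. - (f (y k) * (Phi n m (cheb_node n h) (y k) * Phi (3 * n) m (cheb_node n h) x)))"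
  proof (rule sum.cong[OF refl])
    fix h assume "h \<in> {1..n}"
    show "f (cheb_node n h) * Phi (3 * n) m (cheb_node n h) x =
      (\<Sum>k=1..2*n. - (f (y k) * (Phi n m (cheb_node n h) (y k) * Phi (3 * n) m (cheb_node n h) x)))"
      unfolding coarse[OF \<open>h \<in> {1..n}\<close>] sum_negf mult_minus_left sum_distrib_right
      by (intro arg_cong[where f=uminus] sum.cong) (simp_all add: mult_ac)
  qed
  also have "\<dots> = (\<Sum>k=1..2*n. \<Sum>h=1..n. - (f (y k) * (Phi n m (cheb_node n h) (y k) * Phi (3 * n) m (cheb_node n h) x)))"
    by (rule sum.swap)
  finally show ?thesis
    unfolding f_expand[of x] wavelet_def scaling_fun_def
    by (simp add: right_diff_distrib sum_subtractf sum_negf sum_distrib_left)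
qed

lemma wavelet_interpolating_basis:
  assumes "0 < m" "m < n" and y: "bij_betw y {1..2*n} (Y_nodes n)"
  shows "interpolating_basis n m y (\<lambda>k. wavelet n m (y k))"
proof -
  define \<psi> where "\<psi> k = wavelet n m (y k)" for k
  have yY: "y k \<in> Y_nodes n" if "k \<in> {1..2*n}" for k
    using y that by (auto simp: bij_betw_def)
  \<comment> \<open>Injectivity and independence both follow by evaluating at the nodes
    \<open>y h\<close>.\<close>
  have delta: "\<psi> k (y h) = (if h = k then 1 else 0)" if "h \<in> {1..2*n}" "k \<in> {1..2*n}" for h k
  proof -
    have "y k = y h \<longleftrightarrow> h = k"
      using y that by (auto simp: bij_betw_def inj_on_def simp del: atLeastAtMost_iff)
    then show ?thesis
      unfolding \<psi>_def using wavelet_Y_nodes[OF assms(1,2) yY[OF that(2)] yY[OF that(1)]] by simp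
  qed
  have inj: "inj_on \<psi> {1..2*n}"
  proof (rule inj_onI)
    fix j k assume jk: "j \<in> {1..2*n}" "k \<in> {1..2*n}" "\<psi> j = \<psi> k"
    then show "j = k"
      using delta[OF jk(1,1)] delta[OF jk(1,2)] by (auto split: if_splits)
  qed
  have indep: "fun_space.independent (\<psi> ` {1..2*n})"
  proof (rule fun_space.independent_if_scalars_zero)
    fix u g assume zero: "(\<Sum>g\<in>\<psi> ` {1..2*n}. (\<lambda>x. u g * g x)) = (0 :: real \<Rightarrow> real)"
      and "g \<in> \<psi> ` {1..2*n}"
    then obtain h where h: "h \<in> {1..2*n}" "g = \<psi> h" by blast
    have "(\<Sum>k=1..2*n. u (\<psi> k) * \<psi> k (y h)) = 0"
      using fun_cong[OF zero, of "y h"] unfolding sum_fun_eq sum.reindex[OF inj] by simp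
    also have "(\<Sum>k=1..2*n. u (\<psi> k) * \<psi> k (y h)) = (\<Sum>k=1..2*n. if h = k then u (\<psi> k) else 0)"
      using h by (intro sum.cong refl) (simp add: delta)
    finally show "u g = 0" using h by simp
  qed simp
  have span1: "W_space n m \<subseteq> fun_space.span (\<psi> ` {1..2*n})"
  proof
    fix f assume f: "f \<in> W_space n m"
    have "f = (\<lambda>x. \<Sum>k=1..2*n. f (y k) * \<psi> k x)"
      unfolding \<psi>_def using W_space_expand[OF assms(1,2) f y] by (rule ext)
    moreover have "(\<lambda>x. \<Sum>k=1..2*n. f (y k) * \<psi> k x) \<in> fun_space.span (\<psi> ` {1..2*n})"
      by (intro fun_span_sum fun_space.span_scale fun_space.span_base imageI)
    ultimately show "f \<in> fun_space.span (\<psi> ` {1..2*n})" by simp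
  qed
  have span2: "fun_space.span (\<psi> ` {1..2*n}) \<subseteq> W_space n m"
  proof (rule fun_space.span_minimal)
    show "\<psi> ` {1..2*n} \<subseteq> W_space n m"
      using wavelet_in_W_space[OF assms(1,2)] yY by (auto simp: \<psi>_def)
    have V: "g \<in> V_space N m \<Longrightarrow> cont g" for g N
      using V_space_subset_cheb_space[OF assms(1) order_refl] continuous_on_cheb_space by blast
    show "fun_space.subspace (W_space n m)"
    proof (rule fun_space.subspaceI)
      show "0 \<in> W_space n m"
        by (simp add: W_space_def V_space_def fun_space.span_zero inner_w_def)
    next
      fix f g assume fg: "f \<in> W_space n m" "g \<in> W_space n m"
      have "inner_w (f + g) h = 0" if h: "h \<in> V_space n m" for h
      proof -
        have c: "cont f" "cont g" "cont h"
          using fg h V by (auto simp: W_space_def)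
        have "inner_w (f + g) h = cheb_integral (\<lambda>x. f x * h x + g x * h x)"
          using c by (subst inner_w_eq) (auto simp: plus_fun_def distrib_right intro: continuous_intros)
        also have "\<dots> = inner_w f h + inner_w g h"
          using c by (subst cheb_integral_add) (auto simp: inner_w_eq intro: continuous_on_mult)
        finally show ?thesis using fg h by (simp add: W_space_def)
      qed
      then show "f + g \<in> W_space n m"
        using fg by (auto simp: W_space_def V_space_def intro: fun_space.span_add)
    next
      fix c f assume f: "f \<in> W_space n m"
      have "inner_w (\<lambda>x. c * f x) h = 0" if h: "h \<in> V_space n m" for h
      proof -
        have c: "cont f" "cont h"
          using f h V by (auto simp: W_space_def)
        then have "inner_w (\<lambda>x. c * f x) h = c * inner_w f h"
          by (simp add: inner_w_eq continuous_on_mult_left mult.assoc cheb_integral_cmult)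
        then show ?thesis using f h by (simp add: W_space_def)
      qed
      then show "(\<lambda>x. c * f x) \<in> W_space n m"
        using f by (auto simp: W_space_def V_space_def intro: fun_space.span_scale)
    qed
  qed
  show ?thesis
    unfolding interpolating_basis_def \<psi>_def[symmetric]
    using inj indep span1 span2 delta by blast
qed

section \<open>Norm estimates\<close>

text \<open>A common majorant for the kernel sums and integrals below. \<open>162 = 9 * 18\<close>
  combines the Marcinkiewicz constant with the kernel integral; the further factor 3 pays either for
  \<open>ln 3\<close> or for the ratio of the grids \<open>3 * n\<close> and
  \<open>n\<close>.\<close>

definition lebesgue_bound :: "nat \<Rightarrow> nat \<Rightarrow> real" where
  "lebesgue_bound n m = 486 * (1 + ln (real n / real m))"

lemma ln_ratio_triple_le:
  assumes "0 < m" "m < n"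
  shows "162 * (1 + ln (real (3 * n) / real m)) \<le> lebesgue_bound n m"
proof -
  have "ln (3 * (real n / real m)) = ln 3 + ln (real n / real m)"
    using assms by (intro ln_mult_pos) auto
  moreover have "ln (3::real) \<le> 3 - 1"
    by (rule ln_le_minus_one) simp
  moreover have "0 \<le> ln (real n / real m)"
    using assms by simp
  ultimately show ?thesis
    by (simp add: lebesgue_bound_def)
qed

lemma lebesgue_bound_ge_1:
  assumes "0 < m" "m < n" shows "1 \<le> lebesgue_bound n m"
proof -
  have "0 \<le> ln (real n / real m)" using assms by simp
  then show ?thesis by (simp add: lebesgue_bound_def)
qed

text \<open>The grid may be finer than the kernel: \<open>m < N \<le> M\<close> keeps the degree
  \<open>N + m - 1\<close> below \<open>2 * M\<close>. Both \<open>M = N\<close> and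
  \<open>M = 3 * N\<close> are used.\<close>

lemma sum_nodes_abs_v_kernel_le:
  assumes "0 < m" "m < N" "N \<le> M" "x \<in> {-1..1}"
  shows "pi / real M * (\<Sum>k=1..M. \<bar>v_kernel N m x (cheb_node M k)\<bar>) \<le>
    162 * (1 + ln (real N / real m))"
proof -
  have "v_kernel N m x \<in> cheb_space (2 * M)"
    using assms by (intro cheb_space_v_kernel) auto
  from marcinkiewicz_nodes[OF _ this, of 1]
  have "pi / real M * (\<Sum>k=1..M. \<bar>v_kernel N m x (cheb_node M k)\<bar>) \<le>
      9 * cheb_integral (\<lambda>y. \<bar>v_kernel N m x y\<bar>)"
    using assms by simp
  also have "\<dots> \<le> 9 * (18 * (1 + ln (real N / real m)))"
    using assms by (intro mult_left_mono cheb_integral_abs_v_kernel_le) auto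
  finally show ?thesis by simp
qed

lemma sum_nodes_abs_Phi_triple_le:
  assumes "0 < m" "m < n" "x \<in> {-1..1}"
  shows "(\<Sum>k=1..3*n. \<bar>Phi (3 * n) m (cheb_node (3 * n) k) x\<bar>) \<le> lebesgue_bound n m"
proof -
  have "(\<Sum>k=1..3*n. \<bar>Phi (3 * n) m (cheb_node (3 * n) k) x\<bar>) =
      pi / real (3 * n) * (\<Sum>k=1..3*n. \<bar>v_kernel (3 * n) m x (cheb_node (3 * n) k)\<bar>)"
    unfolding Phi_def sum_distrib_left
    by (rule sum.cong) (simp_all add: abs_mult v_kernel_commute[of _ _ x])
  also have "\<dots> \<le> 162 * (1 + ln (real (3 * n) / real m))"
    using assms by (intro sum_nodes_abs_v_kernel_le) auto
  also have "\<dots> \<le> lebesgue_bound n m"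
    by (rule ln_ratio_triple_le[OF assms(1,2)])
  finally show ?thesis .
qed

lemma cheb_integral_abs_Phi_triple_le:
  assumes "0 < m" "m < n" "z \<in> {-1..1}"
  shows "cheb_integral (\<lambda>x. \<bar>Phi (3 * n) m z x\<bar>) \<le> pi / real (3 * n) * lebesgue_bound n m"
proof -
  have "cheb_integral (\<lambda>x. \<bar>Phi (3 * n) m z x\<bar>) =
      cheb_integral (\<lambda>x. pi / real (3 * n) * \<bar>v_kernel (3 * n) m z x\<bar>)"
    by (rule cheb_integral_cong) (simp add: Phi_def abs_mult)
  also have "\<dots> = pi / real (3 * n) * cheb_integral (\<lambda>x. \<bar>v_kernel (3 * n) m z x\<bar>)"
    by (rule cheb_integral_cmult)
  also have "\<dots> \<le> pi / real (3 * n) * lebesgue_bound n m"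
  proof (rule mult_left_mono)
    have "0 \<le> ln (real (3 * n) / real m)" using assms by simp
    then have "18 * (1 + ln (real (3 * n) / real m)) \<le> 162 * (1 + ln (real (3 * n) / real m))"
      by (intro mult_right_mono) auto
    then have "18 * (1 + ln (real (3 * n) / real m)) \<le> lebesgue_bound n m"
      using ln_ratio_triple_le[OF assms(1,2)] by (rule order_trans)
    moreover have "cheb_integral (\<lambda>x. \<bar>v_kernel (3 * n) m z x\<bar>) \<le> 18 * (1 + ln (real (3 * n) / real m))"
      using assms by (intro cheb_integral_abs_v_kernel_le) auto
    ultimately show "cheb_integral (\<lambda>x. \<bar>v_kernel (3 * n) m z x\<bar>) \<le> lebesgue_bound n m"
      by (rule order_trans[rotated])
  qed simp
  finally show ?thesis .
qed

lemma sum_nodes_abs_Phi_le: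
  assumes "0 < m" "m < n" "z \<in> {-1..1}"
  shows "(\<Sum>h=1..n. \<bar>Phi n m (cheb_node n h) z\<bar>) \<le> lebesgue_bound n m"
proof -
  have "(\<Sum>h=1..n. \<bar>Phi n m (cheb_node n h) z\<bar>) =
      pi / real n * (\<Sum>h=1..n. \<bar>v_kernel n m z (cheb_node n h)\<bar>)"
    unfolding Phi_def sum_distrib_left
    by (rule sum.cong) (simp_all add: abs_mult v_kernel_commute[of _ _ z])
  also have "\<dots> \<le> 162 * (1 + ln (real n / real m))"
    using assms by (intro sum_nodes_abs_v_kernel_le) auto
  also have "\<dots> \<le> lebesgue_bound n m"
    using assms by (simp add: lebesgue_bound_def)
  finally show ?thesis .
qed

lemma sum_Y_nodes_abs_Phi_le:
  assumes "0 < m" "m < n" "z \<in> {-1..1}" and y: "bij_betw y {1..2*n} (Y_nodes n)"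
  shows "(\<Sum>k=1..2*n. \<bar>Phi n m z (y k)\<bar>) \<le> lebesgue_bound n m"
proof -
  have "(\<Sum>k=1..2*n. \<bar>Phi n m z (y k)\<bar>) \<le> (\<Sum>k=1..3*n. \<bar>Phi n m z (cheb_node (3 * n) k)\<bar>)"
    unfolding sum_nodes_split[OF y, of "\<lambda>w. \<bar>Phi n m z w\<bar>"] by (simp add: sum_nonneg)
  also have "\<dots> = 3 * (pi / real (3 * n) * (\<Sum>k=1..3*n. \<bar>v_kernel n m z (cheb_node (3 * n) k)\<bar>))"
    unfolding Phi_def sum_distrib_left by (rule sum.cong) (simp_all add: abs_mult)
  also have "\<dots> \<le> 3 * (162 * (1 + ln (real n / real m)))"
    using assms by (intro mult_left_mono sum_nodes_abs_v_kernel_le) auto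
  finally show ?thesis by (simp add: lebesgue_bound_def)
qed

lemma abs_wavelet_le:
  "\<bar>wavelet n m z x\<bar> \<le> \<bar>Phi (3 * n) m z x\<bar> +
    (\<Sum>h=1..n. \<bar>Phi n m (cheb_node n h) z\<bar> * \<bar>Phi (3 * n) m (cheb_node n h) x\<bar>)"
proof -
  have "\<bar>\<Sum>h=1..n. scaling_fun n m h z * Phi (3 * n) m (cheb_node n h) x\<bar> \<le>
      (\<Sum>h=1..n. \<bar>Phi n m (cheb_node n h) z\<bar> * \<bar>Phi (3 * n) m (cheb_node n h) x\<bar>)"
    by (rule order_trans[OF sum_abs]) (simp add: scaling_fun_def abs_mult)
  then show ?thesis
    unfolding wavelet_def by linarith
qed

text \<open>Swapping the sums bounds the inner coarse sum by \<open>\<Lambda>\<close>. Since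
  \<open>1 \<le> \<Lambda>\<close>, the direct terms over \<open>Y_nodes n\<close> may take the same
  factor, and both parts merge into one sum of the fine kernel over all \<open>3 * n\<close>
  nodes.\<close>

lemma sum_abs_wavelet_le:
  assumes "0 < m" "m < n" "x \<in> {-1..1}" and y: "bij_betw y {1..2*n} (Y_nodes n)"
  shows "(\<Sum>k=1..2*n. \<bar>wavelet n m (y k) x\<bar>) \<le> (lebesgue_bound n m)\<^sup>2"
proof -
  define \<Lambda> where "\<Lambda> = lebesgue_bound n m"
  have \<Lambda>: "1 \<le> \<Lambda>" unfolding \<Lambda>_def by (rule lebesgue_bound_ge_1[OF assms(1,2)])
  define P where "P z = \<bar>Phi (3 * n) m z x\<bar>" for z
  have P0: "0 \<le> P z" for z by (simp add: P_def)
  have "(\<Sum>k=1..2*n. \<bar>wavelet n m (y k) x\<bar>) \<le>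
      (\<Sum>k=1..2*n. P (y k) + (\<Sum>h=1..n. \<bar>Phi n m (cheb_node n h) (y k)\<bar> * P (cheb_node n h)))"
    unfolding P_def by (intro sum_mono abs_wavelet_le)
  also have "\<dots> = (\<Sum>k=1..2*n. P (y k)) +
      (\<Sum>h=1..n. (\<Sum>k=1..2*n. \<bar>Phi n m (cheb_node n h) (y k)\<bar>) * P (cheb_node n h))"
    unfolding sum.distrib sum_distrib_right by (subst sum.swap) simp
  also have "\<dots> \<le> \<Lambda> * (\<Sum>k=1..2*n. P (y k)) + (\<Sum>h=1..n. \<Lambda> * P (cheb_node n h))"
  proof (intro add_mono sum_mono mult_right_mono P0)
    show "(\<Sum>k=1..2*n. P (y k)) \<le> \<Lambda> * (\<Sum>k=1..2*n. P (y k))"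
      using mult_right_mono[OF \<Lambda>, of "\<Sum>k=1..2*n. P (y k)"] P0 by (simp add: sum_nonneg)
    show "(\<Sum>k=1..2*n. \<bar>Phi n m (cheb_node n h) (y k)\<bar>) \<le> \<Lambda>" for h
      unfolding \<Lambda>_def by (rule sum_Y_nodes_abs_Phi_le[OF assms(1,2) cheb_node_mem y])
  qed
  also have "\<dots> = \<Lambda> * (\<Sum>k=1..3*n. P (cheb_node (3 * n) k))"
    unfolding sum_nodes_split[OF y, of P] sum_distrib_left[symmetric] distrib_left ..
  also have "\<dots> \<le> \<Lambda> * \<Lambda>"
    using sum_nodes_abs_Phi_triple_le[OF assms(1-3)] \<Lambda>
    by (intro mult_left_mono) (auto simp: P_def \<Lambda>_def)
  finally show ?thesis
    by (simp add: \<Lambda>_def power2_eq_square)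
qed

lemma cheb_integral_abs_wavelet_le:
  assumes "0 < m" "m < n" "z \<in> {-1..1}"
  shows "cheb_integral (\<lambda>x. \<bar>wavelet n m z x\<bar>) \<le>
    pi / real (3 * n) * (2 * (lebesgue_bound n m)\<^sup>2)"
proof -
  define \<Lambda> where "\<Lambda> = lebesgue_bound n m"
  define c where "c = pi / real (3 * n)"
  have \<Lambda>: "1 \<le> \<Lambda>" unfolding \<Lambda>_def by (rule lebesgue_bound_ge_1[OF assms(1,2)])
  define P where "P z x = \<bar>Phi (3 * n) m z x\<bar>" for z x
  have cP: "cont (P z)" for z unfolding P_def by (intro continuous_intros)
  have IP: "cheb_integral (P z) \<le> c * \<Lambda>" if "z \<in> {-1..1}" for z
    unfolding P_def \<Lambda>_def c_def by (rule cheb_integral_abs_Phi_triple_le[OF assms(1,2) that])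
  have "cheb_integral (\<lambda>x. \<bar>wavelet n m z x\<bar>) \<le>
      cheb_integral (\<lambda>x. P z x + (\<Sum>h=1..n. \<bar>Phi n m (cheb_node n h) z\<bar> * P (cheb_node n h) x))"
    by (intro cheb_integral_mono continuous_intros cP) (simp only: P_def abs_wavelet_le)
  also have "\<dots> = cheb_integral (P z) +
      cheb_integral (\<lambda>x. \<Sum>h=1..n. \<bar>Phi n m (cheb_node n h) z\<bar> * P (cheb_node n h) x)"
    by (rule cheb_integral_add) (intro continuous_intros cP)+
  also have "cheb_integral (\<lambda>x. \<Sum>h=1..n. \<bar>Phi n m (cheb_node n h) z\<bar> * P (cheb_node n h) x) =
      (\<Sum>h=1..n. cheb_integral (\<lambda>x. \<bar>Phi n m (cheb_node n h) z\<bar> * P (cheb_node n h) x))"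
    by (rule cheb_integral_sum) (simp, intro continuous_intros cP)
  also have "cheb_integral (P z) + \<dots> \<le>
      c * \<Lambda> + (\<Sum>h=1..n. \<bar>Phi n m (cheb_node n h) z\<bar> * (c * \<Lambda>))"
    unfolding cheb_integral_cmult
    by (intro add_mono sum_mono mult_left_mono IP cheb_node_mem assms) simp
  also have "\<dots> \<le> c * \<Lambda> + \<Lambda> * (c * \<Lambda>)"
    unfolding sum_distrib_right[symmetric]
    using sum_nodes_abs_Phi_le[OF assms] \<Lambda>
    by (intro add_left_mono mult_right_mono) (auto simp: \<Lambda>_def c_def)
  also have "\<dots> \<le> c * (2 * \<Lambda>\<^sup>2)"
  proof -
    have "\<Lambda> * 1 \<le> \<Lambda> * \<Lambda>" using \<Lambda> by (intro mult_left_mono) auto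
    then have "c * (\<Lambda> + \<Lambda> * \<Lambda>) \<le> c * (2 * \<Lambda>\<^sup>2)"
      by (intro mult_left_mono) (auto simp: c_def power2_eq_square)
    then show ?thesis by (simp add: algebra_simps)
  qed
  finally show ?thesis by (simp add: c_def \<Lambda>_def)
qed

section \<open>From kernel bounds to the p-norms\<close>

lemma norm_w_finite:
  assumes "cont f" "1 \<le> q"
  shows "norm_w (ereal q) f = cheb_integral (\<lambda>x. \<bar>f x\<bar> powr q) powr (1 / q)"
  using lborel_integral_weight[OF cont_abs_powr[OF assms]] by (simp add: norm_w_def)

lemma abs_le_norm_w_infinity:
  assumes "cont f" "x \<in> {-1..1}"
  shows "\<bar>f x\<bar> \<le> norm_w \<infinity> f"
proof -
  have "compact ((\<lambda>x. \<bar>f x\<bar>) ` {-1..1})"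
    by (intro compact_continuous_image continuous_intros assms(1)) simp
  then have "bdd_above ((\<lambda>x. \<bar>f x\<bar>) ` {-1..1})"
    by (intro bounded_imp_bdd_above compact_imp_bounded)
  from cSUP_upper[OF assms(2) this] show ?thesis
    by (simp add: norm_w_def)
qed

text \<open>In the Schur test \<open>\<Gamma>\<close> bounds the sum over \<open>k\<close> at each
  point and \<open>pi / (3 * n) * \<Gamma>\<close> the integral of each wavelet. Jensen contributes
  \<open>\<Gamma> powr (q - 1)\<close> and the integrals one more \<open>\<Gamma>\<close>, so the
  q-th root returns \<open>\<Gamma>\<close> for every \<open>q\<close>.\<close>

lemma norm_w_upper:
  assumes "0 < m" "m < n" and y: "bij_betw y {1..2*n} (Y_nodes n)" and "1 \<le> p"
  shows "norm_w p (\<lambda>x. \<Sum>k=1..2*n. b k * wavelet n m (y k) x) \<le>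
    2 * (lebesgue_bound n m)\<^sup>2 * norm_l p (2 * n) b"
proof -
  define f where "f x = (\<Sum>k=1..2*n. b k * wavelet n m (y k) x)" for x
  define \<Gamma> where "\<Gamma> = 2 * (lebesgue_bound n m)\<^sup>2"
  have \<Gamma>: "0 < \<Gamma>"
    using lebesgue_bound_ge_1[OF assms(1,2)] by (simp add: \<Gamma>_def)
  have cf: "cont f"
    unfolding f_def by (intro continuous_intros)
  have y1: "y k \<in> {-1..1}" if "k \<in> {1..2*n}" for k
    using y that by (intro Y_nodesD(1)[of _ n]) (auto simp: bij_betw_def)
  have S: "(\<Sum>k=1..2*n. \<bar>wavelet n m (y k) x\<bar>) \<le> \<Gamma>" if "x \<in> {-1..1}" for x
  proof -
    have "(\<Sum>k=1..2*n. \<bar>wavelet n m (y k) x\<bar>) \<le> (lebesgue_bound n m)\<^sup>2"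
      by (rule sum_abs_wavelet_le[OF assms(1,2) that y])
    then show ?thesis unfolding \<Gamma>_def by (smt (verit) zero_le_power2)
  qed
  have abs_f: "\<bar>f x\<bar> \<le> (\<Sum>k=1..2*n. \<bar>b k\<bar> * \<bar>wavelet n m (y k) x\<bar>)" for x
    unfolding f_def by (rule order_trans[OF sum_abs]) (simp add: abs_mult)
  have "norm_w p f \<le> \<Gamma> * norm_l p (2 * n) b"
  proof (cases p)
    case PInf
    define B where "B = norm_l \<infinity> (2 * n) b"
    have B: "\<bar>b k\<bar> \<le> B" if "k \<in> {1..2*n}" for k
      unfolding B_def norm_l_def using that by (auto intro!: Max_ge)
    have "0 \<le> B" using B[of 1] assms by auto
    have "norm_w \<infinity> f = (SUP x\<in>{-1..1}. \<bar>f x\<bar>)"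
      by (simp add: norm_w_def)
    also have "\<dots> \<le> \<Gamma> * B"
    proof (rule cSUP_least)
      fix x :: real assume x: "x \<in> {-1..1}"
      have "\<bar>f x\<bar> \<le> (\<Sum>k=1..2*n. B * \<bar>wavelet n m (y k) x\<bar>)"
        by (rule order_trans[OF abs_f]) (intro sum_mono mult_right_mono B abs_ge_zero)
      also have "\<dots> \<le> B * \<Gamma>"
        unfolding sum_distrib_left[symmetric] by (intro mult_left_mono S x \<open>0 \<le> B\<close>)
      finally show "\<bar>f x\<bar> \<le> \<Gamma> * B" by (simp add: mult.commute)
    qed simp
    finally show ?thesis by (simp add: PInf B_def)
  next
    case (real q)
    have q: "1 \<le> q" using assms(4) real by simp
    have cW: "cont (\<lambda>x. \<bar>wavelet n m z x\<bar>)" for z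
      by (intro continuous_intros)
    have point: "\<bar>f x\<bar> powr q \<le> \<Gamma> powr (q - 1) * (\<Sum>k=1..2*n. \<bar>b k\<bar> powr q * \<bar>wavelet n m (y k) x\<bar>)"
      if x: "x \<in> {-1..1}" for x
    proof -
      have "\<bar>f x\<bar> powr q \<le> (\<Sum>k=1..2*n. \<bar>b k\<bar> * \<bar>wavelet n m (y k) x\<bar>) powr q"
        using abs_f q by (intro powr_mono2) auto
      also have "\<dots> \<le> \<Gamma> powr (q - 1) * (\<Sum>k=1..2*n. \<bar>b k\<bar> powr q * \<bar>wavelet n m (y k) x\<bar>)"
        using q \<Gamma> S[OF x] by (intro jensen_sum) auto
      finally show ?thesis .
    qed
    have "cheb_integral (\<lambda>x. \<bar>f x\<bar> powr q) \<le>
        cheb_integral (\<lambda>x. \<Gamma> powr (q - 1) * (\<Sum>k=1..2*n. \<bar>b k\<bar> powr q * \<bar>wavelet n m (y k) x\<bar>))"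
      by (intro cheb_integral_mono cont_abs_powr cf q continuous_intros point)
    also have "\<dots> = \<Gamma> powr (q - 1) * (\<Sum>k=1..2*n. cheb_integral (\<lambda>x. \<bar>b k\<bar> powr q * \<bar>wavelet n m (y k) x\<bar>))"
      unfolding cheb_integral_cmult[of "\<Gamma> powr (q - 1)"]
      by (subst cheb_integral_sum) (simp_all add: continuous_on_mult_left cW)
    also have "\<dots> \<le> \<Gamma> powr (q - 1) * (\<Sum>k=1..2*n. \<bar>b k\<bar> powr q * (pi / real (3 * n) * \<Gamma>))"
      unfolding cheb_integral_cmult \<Gamma>_def
      by (intro mult_left_mono sum_mono cheb_integral_abs_wavelet_le assms(1,2) y1) auto
    also have "\<dots> = \<Gamma> powr q * (pi / real (3 * n) * (\<Sum>k=1..2*n. \<bar>b k\<bar> powr q))"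
    proof -
      have "\<Gamma> powr q = \<Gamma> * \<Gamma> powr (q - 1)"
        using \<Gamma> by (simp add: powr_mult_base)
      then show ?thesis
        unfolding sum_distrib_right[symmetric] by (simp only: mult_ac)
    qed
    \<comment> \<open>The fine-grid weight \<open>pi / (3 * n)\<close> is enlarged to the weight
      \<open>pi / (2 * n)\<close> of \<open>norm_l\<close>.\<close>
    also have "\<dots> \<le> \<Gamma> powr q * (pi / real (2 * n) * (\<Sum>k=1..2*n. \<bar>b k\<bar> powr q))"
      using assms by (intro mult_left_mono mult_right_mono divide_left_mono sum_nonneg) auto
    finally have "cheb_integral (\<lambda>x. \<bar>f x\<bar> powr q) powr (1 / q) \<le>
        (\<Gamma> powr q * (pi / real (2 * n) * (\<Sum>k=1..2*n. \<bar>b k\<bar> powr q))) powr (1 / q)"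
      using q by (intro powr_mono2 cheb_integral_nonneg cont_abs_powr cf) auto
    also have "\<dots> = \<Gamma> * norm_l p (2 * n) b"
    proof -
      have "0 \<le> pi / real (2 * n) * (\<Sum>k=1..2*n. \<bar>b k\<bar> powr q)"
        by (intro mult_nonneg_nonneg sum_nonneg) auto
      then have "(\<Gamma> powr q * (pi / real (2 * n) * (\<Sum>k=1..2*n. \<bar>b k\<bar> powr q))) powr (1 / q) =
          (\<Gamma> powr q) powr (1 / q) * (pi / real (2 * n) * (\<Sum>k=1..2*n. \<bar>b k\<bar> powr q)) powr (1 / q)"
        by (intro powr_mult)
      then show ?thesis
        using q \<Gamma> by (simp add: powr_powr norm_l_def real)
    qed
    finally show ?thesis
      using norm_w_finite[OF cf q] by (simp add: real)
  qed (use assms in simp)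
  then show ?thesis by (simp add: f_def[abs_def] \<Gamma>_def)
qed

text \<open>By interpolation the \<open>b k\<close> are the values of the sum at
  \<open>Y_nodes n\<close>, a subset of the fine nodes, and the sum has degree below
  \<open>6 * n\<close>, the range of the Marcinkiewicz inequality with \<open>3 * n\<close>
  nodes.\<close>

lemma norm_w_lower:
  assumes "0 < m" "m < n" and y: "bij_betw y {1..2*n} (Y_nodes n)" and "1 \<le> p"
  shows "1 / 18 * norm_l p (2 * n) b \<le> norm_w p (\<lambda>x. \<Sum>k=1..2*n. b k * wavelet n m (y k) x)"
proof -
  define f where "f x = (\<Sum>k=1..2*n. b k * wavelet n m (y k) x)" for x
  have cf: "cont f"
    unfolding f_def by (intro continuous_intros)
  have yY: "y k \<in> Y_nodes n" if "k \<in> {1..2*n}" for k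
    using y that by (auto simp: bij_betw_def)
  have fy: "f (y h) = b h" if h: "h \<in> {1..2*n}" for h
  proof -
    have "f (y h) = (\<Sum>k=1..2*n. if h = k then b k else 0)"
      unfolding f_def
    proof (rule sum.cong[OF refl])
      fix k assume k: "k \<in> {1..2*n}"
      have "y k = y h \<longleftrightarrow> h = k"
        using y h k by (auto simp: bij_betw_def inj_on_def simp del: atLeastAtMost_iff)
      then show "b k * wavelet n m (y k) (y h) = (if h = k then b k else 0)"
        using wavelet_Y_nodes[OF assms(1,2) yY[OF k] yY[OF h]] by simp
    qed
    then show ?thesis using h by simp
  qed
  have "norm_l p (2 * n) b \<le> 18 * norm_w p f"
  proof (cases p)
    case PInf
    have "norm_l \<infinity> (2 * n) b = Max ((\<lambda>k. \<bar>b k\<bar>) ` {1..2*n})"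
      by (simp add: norm_l_def)
    also have "\<dots> \<le> norm_w \<infinity> f"
    proof (rule Max.boundedI)
      fix a assume "a \<in> (\<lambda>k. \<bar>b k\<bar>) ` {1..2*n}"
      then obtain k where k: "k \<in> {1..2*n}" "a = \<bar>b k\<bar>" by blast
      then show "a \<le> norm_w \<infinity> f"
        using abs_le_norm_w_infinity[OF cf Y_nodesD(1)[OF yY[OF k(1)]]] fy[OF k(1)] by simp
    qed (use assms in auto)
    also have "\<dots> \<le> 18 * norm_w \<infinity> f"
      using abs_le_norm_w_infinity[OF cf, of 0] by simp
    finally show ?thesis by (simp add: PInf)
  next
    case (real q)
    have q: "1 \<le> q" using assms(4) real by simp
    have "wavelet n m z \<in> cheb_space (2 * (3 * n))" for z
    proof -
      have w: "wavelet n m z = (\<lambda>x. Phi (3 * n) m z x +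
          (\<Sum>h=1..n. - scaling_fun n m h z * Phi (3 * n) m (cheb_node n h) x))"
        by (simp add: wavelet_def fun_eq_iff sum_negf)
      have "Phi (3 * n) m w \<in> cheb_space (2 * (3 * n))" for w
        using assms by (intro cheb_space_Phi) auto
      then have "Phi (3 * n) m z + (\<lambda>x. \<Sum>h=1..n. - scaling_fun n m h z * Phi (3 * n) m (cheb_node n h) x)
          \<in> cheb_space (2 * (3 * n))"
        unfolding cheb_space_def by (intro fun_space.span_add fun_span_sum fun_space.span_scale)
      then show ?thesis by (simp add: w plus_fun_def)
    qed
    then have fs: "f \<in> cheb_space (2 * (3 * n))"
      unfolding f_def[abs_def] by (intro cheb_space_sum cheb_space_scale)
    \<comment> \<open>The weights differ by the factor 3 / 2, enlarged below to
      \<open>2 powr q\<close>; together with \<open>9 powr q\<close> this makes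
      \<open>18 powr q\<close>.\<close>
    have "pi / real (2 * n) * (\<Sum>k=1..2*n. \<bar>b k\<bar> powr q) =
        3 / 2 * (pi / real (3 * n) * (\<Sum>k=1..2*n. \<bar>f (y k)\<bar> powr q))"
      using fy by simp
    also have "\<dots> \<le> 3 / 2 * (pi / real (3 * n) * (\<Sum>k=1..3*n. \<bar>f (cheb_node (3 * n) k)\<bar> powr q))"
      unfolding sum_nodes_split[OF y, of "\<lambda>z. \<bar>f z\<bar> powr q"]
      by (intro mult_left_mono) (auto intro: sum_nonneg)
    also have "\<dots> \<le> 2 powr q * (9 powr q * cheb_integral (\<lambda>x. \<bar>f x\<bar> powr q))"
    proof (rule mult_mono)
      show "3 / 2 \<le> 2 powr q"
        using powr_mono[OF q, of 2] by simp
      show "pi / real (3 * n) * (\<Sum>k=1..3*n. \<bar>f (cheb_node (3 * n) k)\<bar> powr q) \<le>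
          9 powr q * cheb_integral (\<lambda>x. \<bar>f x\<bar> powr q)"
        using assms by (intro marcinkiewicz_nodes fs q) auto
    qed (auto intro!: mult_nonneg_nonneg divide_nonneg_nonneg sum_nonneg)
    also have "\<dots> = 18 powr q * cheb_integral (\<lambda>x. \<bar>f x\<bar> powr q)"
      using powr_mult[of 2 9 q] by simp
    finally have "(pi / real (2 * n) * (\<Sum>k=1..2*n. \<bar>b k\<bar> powr q)) powr (1 / q) \<le>
        (18 powr q * cheb_integral (\<lambda>x. \<bar>f x\<bar> powr q)) powr (1 / q)"
      using q by (intro powr_mono2) (auto intro!: mult_nonneg_nonneg divide_nonneg_nonneg sum_nonneg)
    also have "\<dots> = 18 * norm_w p f"
      using q cheb_integral_nonneg[OF cont_abs_powr[OF cf q]] norm_w_finite[OF cf q]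
      by (simp add: powr_mult powr_powr real)
    finally show ?thesis
      by (simp add: norm_l_def real)
  qed (use assms in simp)
  then show ?thesis by (simp add: f_def[abs_def])
qed

lemma norm_l_nonneg:
  assumes "0 < N" shows "0 \<le> norm_l p N b"
proof -
  have "\<bar>b 1\<bar> \<le> Max ((\<lambda>k. \<bar>b k\<bar>) ` {1..N})"
    using assms by (intro Max_ge) auto
  then show ?thesis
    unfolding norm_l_def by (auto intro: order_trans[OF abs_ge_zero])
qed

text \<open>Uses \<open>(1 + l)\<^sup>2 \<le> 2 * (1 + l\<^sup>2)\<close>; the constants are
  \<open>472392 = 2 * 486\<^sup>2\<close> and its double.\<close>

lemma lebesgue_bound_sq_le:
  "2 * (lebesgue_bound n m)\<^sup>2 \<le> 944784 * (1 + (ln (real n / real m))\<^sup>2)"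
proof -
  define l where "l = ln (real n / real m)"
  have "(1 + l)\<^sup>2 + (1 - l)\<^sup>2 = 2 * (1 + l\<^sup>2)"
    by (simp add: power2_eq_square algebra_simps)
  moreover have "0 \<le> (1 - l)\<^sup>2" by simp
  ultimately have "(1 + l)\<^sup>2 \<le> 2 * (1 + l\<^sup>2)" by linarith
  then have "472392 * (1 + l)\<^sup>2 \<le> 472392 * (2 * (1 + l\<^sup>2))"
    by (rule mult_left_mono) simp
  moreover have "2 * (lebesgue_bound n m)\<^sup>2 = 472392 * (1 + l)\<^sup>2"
    unfolding lebesgue_bound_def power_mult_distrib l_def[symmetric] by simp
  ultimately show ?thesis
    by (simp add: l_def)
qed

theorem theorem4p2:
  shows "(\<forall>(n::nat) (m::nat) (y::nat \<Rightarrow> real).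
            0 < m \<and> m < n \<and> bij_betw y {1..2*n} (Y_nodes n) \<longrightarrow>
            (\<forall>s\<in>{0..n-m}. \<forall>k\<in>{1..2*n}.
               (LINT x:{-1..1}|lborel. x ^ s * wavelet n m (y k) x * weight x) = 0))
       \<and> (\<forall>(n::nat) (m::nat) (y::nat \<Rightarrow> real).
            0 < m \<and> m < n \<and> bij_betw y {1..2*n} (Y_nodes n) \<longrightarrow>
            interpolating_basis n m y (\<lambda>k. wavelet n m (y k)))
       \<and> (\<exists>(C1::real) (C2::real). C1 > 0 \<and> C2 > 0 \<and>
            (\<forall>(n::nat) (m::nat) (y::nat \<Rightarrow> real) (b::nat \<Rightarrow> real) (p::ereal).
               0 < m \<and> m < n \<and> bij_betw y {1..2*n} (Y_nodes n) \<and> 1 \<le> p \<longrightarrow>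
               C1 * norm_l p (2*n) b
                 \<le> norm_w p (\<lambda>x. \<Sum>k=1..2*n. b k * wavelet n m (y k) x) \<and>
               norm_w p (\<lambda>x. \<Sum>k=1..2*n. b k * wavelet n m (y k) x)
                 \<le> C2 * (1 + (ln (real n / real m))\<^sup>2) * norm_l p (2*n) b))"
proof (intro conjI allI impI ballI)
  fix n m :: nat and y :: "nat \<Rightarrow> real" and s k
  assume "0 < m \<and> m < n \<and> bij_betw y {1..2*n} (Y_nodes n)" "s \<in> {0..n-m}"
  then show "(LINT x:{-1..1}|lborel. x ^ s * wavelet n m (y k) x * weight x) = 0"
    by (intro wavelet_moments) auto
next
  fix n m :: nat and y :: "nat \<Rightarrow> real"
  assume "0 < m \<and> m < n \<and> bij_betw y {1..2*n} (Y_nodes n)"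
  then show "interpolating_basis n m y (\<lambda>k. wavelet n m (y k))"
    by (intro wavelet_interpolating_basis) auto
next
  show "\<exists>(C1::real) (C2::real). C1 > 0 \<and> C2 > 0 \<and>
    (\<forall>(n::nat) (m::nat) (y::nat \<Rightarrow> real) (b::nat \<Rightarrow> real) (p::ereal).
       0 < m \<and> m < n \<and> bij_betw y {1..2*n} (Y_nodes n) \<and> 1 \<le> p \<longrightarrow>
       C1 * norm_l p (2*n) b
         \<le> norm_w p (\<lambda>x. \<Sum>k=1..2*n. b k * wavelet n m (y k) x) \<and>
       norm_w p (\<lambda>x. \<Sum>k=1..2*n. b k * wavelet n m (y k) x)
         \<le> C2 * (1 + (ln (real n / real m))\<^sup>2) * norm_l p (2*n) b)"
  \<comment> \<open>The witnesses are the constants of \<open>norm_w_lower\<close> and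
    \<open>lebesgue_bound_sq_le\<close>.\<close>
  proof (rule exI[of _ "1 / 18"], rule exI[of _ 944784], intro conjI allI impI)
    fix n m :: nat and y b :: "nat \<Rightarrow> real" and p :: ereal
    assume "0 < m \<and> m < n \<and> bij_betw y {1..2*n} (Y_nodes n) \<and> 1 \<le> p"
    then have *: "0 < m" "m < n" "bij_betw y {1..2*n} (Y_nodes n)" "1 \<le> p" by auto
    show "1 / 18 * norm_l p (2*n) b \<le> norm_w p (\<lambda>x. \<Sum>k=1..2*n. b k * wavelet n m (y k) x)"
      by (rule norm_w_lower[OF *])
    have "norm_w p (\<lambda>x. \<Sum>k=1..2*n. b k * wavelet n m (y k) x) \<le>
        2 * (lebesgue_bound n m)\<^sup>2 * norm_l p (2*n) b"
      by (rule norm_w_upper[OF *])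
    also have "\<dots> \<le> 944784 * (1 + (ln (real n / real m))\<^sup>2) * norm_l p (2*n) b"
      using * by (intro mult_right_mono lebesgue_bound_sq_le norm_l_nonneg) auto
    finally show "norm_w p (\<lambda>x. \<Sum>k=1..2*n. b k * wavelet n m (y k) x) \<le>
        944784 * (1 + (ln (real n / real m))\<^sup>2) * norm_l p (2*n) b" .
  qed simp_all
qed

end
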